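(* Let $G=SL(2)$ over an algebraically closed field $k$ of characteristic $p>0$, with Weyl group $W=\{e,s_\alpha\}$, and let $\lambda\ge 0$ be a dominant weight, viewed as a non-negative integer. Then $$\mathcal{V}_{B_1}(H^0(e,\lambda))=\mathfrak{u}\quad\text{for all }\lambda,$$ and $$\mathcal{V}_{B_1}(H^0(s_\alpha,\lambda))=\begin{cases}\mathfrak{u}, & p\nmid \lambda+1,\\ \{0\}, & p\mid\lambda+1.\end{cases}$$
   Context: $B$ is the Borel subgroup of $G$ corresponding to the negative root (containing a fixed maximal torus $T$), and $\mathfrak{u}$ is the Lie algebra of its unipotent radical. For $w\in W$, $X(w)$ is the closure of $B\dot wB/B$ in $G/B$; $\mathcal{L}(\lambda)$ is the line bundle on $G/B$ with $H^0(G/B,\mathcal{L}(\lambda))=\operatorname{ind}_B^G\lambda$; and $H^0(w,\lambda)=H^0(X(w),\mathcal{L}(\lambda))$, a $B$-module. Support varieties over the first Frobenius kernel $B_1$: for a finite-dimensional $B_1$-module $M$, $\mathcal{V}_{B_1}(M)$ is the closed subvariety of $\mathcal{V}_{B_1}=\mathrm{Maxspec}\,H(B_1,k)$ (with $H=H^{2\bullet}$ if $p\ne2$, $H=H^\bullet$ if $p=2$) defined by the annihilator of $\mathrm{Ext}^\bullet_{B_1}(M,M)$. It is identified with the rank variety $\{x\in\mathcal{N}_1(\mathfrak{b}) : M \text{ is not projective over the restricted enveloping algebra } k[x]/(x^p)\text{ of }\langle x\rangle\}\cup\{0\}$, where $\mathcal{N}_1(\mathfrak{b})=\{x\in\mathfrak{b}: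 x^{[p]}=0\}=\mathcal{N}_1(\mathfrak{u})$, $\mathfrak{b}=\mathrm{Lie}(B)$. *)

theory Defs
  imports
    "HOL-Analysis.Analysis"
    "HOL-Algebra.Module"
    "HOL-Computational_Algebra.Computational_Algebra"
begin

section \<open>The group SL(2), its negative Borel subgroup, and Lie algebras\<close>

definition SL2 :: "('k::field ^ 2 ^ 2) set" where
  "SL2 = {g. det g = 1}"

definition borel :: "('k::field ^ 2 ^ 2) set" where
  "borel = {b \<in> SL2. b $ 1 $ 2 = 0}"

definition lie_b :: "('k::field ^ 2 ^ 2) set" where
  "lie_b = {x. x $ 1 $ 2 = 0 \<and> x $ 1 $ 1 + x $ 2 $ 2 = 0}"

definition lie_u :: "('k::field ^ 2 ^ 2) set" where
  "lie_u = {x. x $ 1 $ 1 = 0 \<and> x $ 1 $ 2 = 0 \<and> x $ 2 $ 2 = 0}"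

text \<open>The \<open>p\<close>-operation of a Lie algebra of matrices is the \<open>p\<close>-th matrix power.\<close>

definition mat_pow :: "'k::field ^ 2 ^ 2 \<Rightarrow> nat \<Rightarrow> 'k ^ 2 ^ 2" where
  "mat_pow x n = (((**) x) ^^ n) (mat 1)"

definition nullcone_b :: "('k::field ^ 2 ^ 2) set" where
  "nullcone_b = {x \<in> lie_b. mat_pow x CHAR('k) = 0}"

text \<open>The character of \<open>borel\<close> that restricts to \<open>diag(t, 1/t) \<mapsto> t ^ n\<close> on the torus.\<close>

definition weight :: "nat \<Rightarrow> 'k::field ^ 2 ^ 2 \<Rightarrow> 'k" where
  "weight n b = (b $ 1 $ 1) ^ n"


section \<open>Zariski topology, the flag variety and Schubert varieties\<close>

text \<open>
  The polynomial functions of the four matrix entries. Restricting them to a Zariski closed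
  subset of \<open>SL2\<close> gives its coordinate ring.
\<close>

inductive_set poly_funs :: "('k::field ^ 2 ^ 2 \<Rightarrow> 'k) set" where
  const: "(\<lambda>_. c) \<in> poly_funs"
| entry: "(\<lambda>g. g $ i $ j) \<in> poly_funs"
| add: "F \<in> poly_funs \<Longrightarrow> H \<in> poly_funs \<Longrightarrow> (\<lambda>g. F g + H g) \<in> poly_funs"
| mult: "F \<in> poly_funs \<Longrightarrow> H \<in> poly_funs \<Longrightarrow> (\<lambda>g. F g * H g) \<in> poly_funs"

definition zariski_closed :: "('k::field ^ 2 ^ 2) set \<Rightarrow> bool" where
  "zariski_closed Z \<longleftrightarrow> (\<exists>S \<subseteq> poly_funs. Z = {g \<in> SL2. \<forall>F \<in> S. F g = 0})"

definition flag_point :: "'k::field ^ 2 ^ 2 \<Rightarrow> ('k ^ 2 ^ 2) set" where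
  "flag_point g = {g ** b | b. b \<in> borel}"

definition flag_variety :: "('k::field ^ 2 ^ 2) set set" where
  "flag_variety = flag_point ` SL2"

text \<open>\<open>G/B\<close> carries the quotient topology.\<close>

definition flag_closed :: "('k::field ^ 2 ^ 2) set set \<Rightarrow> bool" where
  "flag_closed Z \<longleftrightarrow> Z \<subseteq> flag_variety \<and> zariski_closed (\<Union>Z)"

datatype weyl = W_e | W_s

text \<open>Representatives of the Weyl group elements in the normalizer of the diagonal torus.\<close>

fun weyl_rep :: "weyl \<Rightarrow> 'k::field ^ 2 ^ 2" where
  "weyl_rep W_e = mat 1"
| "weyl_rep W_s = vector [vector [0, 1], vector [-1, 0]]"

definition schubert :: "weyl \<Rightarrow> ('k::field ^ 2 ^ 2) set set" where
  "schubert w = \<Inter>{Z. flag_closed Z \<and> {flag_point (b ** weyl_rep w) | b. b \<in> borel} \<subseteq> Z}"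


section \<open>Sections of line bundles as \<open>B\<close>-modules\<close>

record ('k, 'v) B_module = "('k, 'v) module" +
  b_act :: "'k ^ 2 ^ 2 \<Rightarrow> 'v \<Rightarrow> 'v"

text \<open>
  A section over \<open>X(w)\<close> of the line bundle with \<open>H\<^sup>0(G/B, L(n)) = ind\<^sub>B\<^sup>G n\<close> is a regular function
  \<open>f\<close> on the preimage of \<open>X(w)\<close> in \<open>G\<close> with \<open>f (g b) = n(b)\<^sup>-\<^sup>1 f g\<close>; it is extended by zero outside
  of this preimage. \<open>B\<close> acts by \<open>(b f) g = f (b\<^sup>-\<^sup>1 g)\<close>.
  The fields \<open>mult\<close> and \<open>one\<close> of a module record play no role.
\<close>

definition H0 :: "weyl \<Rightarrow> nat \<Rightarrow> ('k::field, 'k ^ 2 ^ 2 \<Rightarrow> 'k) B_module" where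
  "H0 w n =
    \<lparr> carrier = {f. (\<forall>g. g \<notin> \<Union>(schubert w) \<longrightarrow> f g = 0)
                  \<and> (\<exists>F \<in> poly_funs. \<forall>g \<in> \<Union>(schubert w). f g = F g)
                  \<and> (\<forall>g \<in> \<Union>(schubert w). \<forall>b \<in> borel. f (g ** b) = inverse (weight n b) * f g)},
      mult = undefined,
      one = undefined,
      zero = (\<lambda>g. 0),
      add = (\<lambda>f h g. f g + h g),
      smult = (\<lambda>c f g. c * f g),
      b_act = (\<lambda>b f g. f (matrix_inv b ** g)) \<rparr>"


section \<open>The derived action of \<open>Lie(B)\<close>\<close>

text \<open>The derivative at the identity of a polynomial function \<open>F\<close> in the direction \<open>x\<close>: the
  coefficient of \<open>t\<close> in \<open>F (1 + t x)\<close>.\<close>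

definition deriv_at_one :: "('k::field ^ 2 ^ 2 \<Rightarrow> 'k) \<Rightarrow> 'k ^ 2 ^ 2 \<Rightarrow> 'k" where
  "deriv_at_one F x =
    coeff (THE P. \<forall>t. poly P t = F (mat 1 + (\<chi> i j. t * x $ i $ j))) 1"

text \<open>
  Writing \<open>b \<cdot> v = \<Sum>\<^sub>s h\<^sub>s(b) s\<close> with regular coefficients \<open>h\<^sub>s\<close> on \<open>B\<close>, the element \<open>x\<close> of \<open>Lie(B)\<close>
  acts by \<open>x \<cdot> v = \<Sum>\<^sub>s (d h\<^sub>s)\<^sub>1(x) s\<close>.
\<close>

definition lie_act :: "('k::field, 'v) B_module \<Rightarrow> 'k ^ 2 ^ 2 \<Rightarrow> 'v \<Rightarrow> 'v" where
  "lie_act M x v =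
    (SOME u. \<exists>S h. finite S \<and> S \<subseteq> carrier M \<and> h ` S \<subseteq> poly_funs
        \<and> (\<forall>b \<in> borel. b_act M b v = finsum M (\<lambda>s. h s b \<odot>\<^bsub>M\<^esub> s) S)
        \<and> u = finsum M (\<lambda>s. deriv_at_one (h s) x \<odot>\<^bsub>M\<^esub> s) S)"


section \<open>Projective modules\<close>

definition linear_maps ::
  "('a, 'r) ring_scheme \<Rightarrow> ('a, 'b, 'm) module_scheme \<Rightarrow> ('a, 'c, 'n) module_scheme \<Rightarrow> ('b \<Rightarrow> 'c) set"
where
  "linear_maps R M N = {f \<in> carrier M \<rightarrow> carrier N.
      (\<forall>x \<in> carrier M. \<forall>y \<in> carrier M. f (x \<oplus>\<^bsub>M\<^esub> y) = f x \<oplus>\<^bsub>N\<^esub> f y)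
    \<and> (\<forall>r \<in> carrier R. \<forall>x \<in> carrier M. f (r \<odot>\<^bsub>M\<^esub> x) = r \<odot>\<^bsub>N\<^esub> f x)}"

definition free_module :: "('a, 'r) ring_scheme \<Rightarrow> 'i set \<Rightarrow> ('a, 'i \<Rightarrow> 'a) module" where
  "free_module R I =
    \<lparr> carrier = {\<phi>. (\<forall>i \<in> I. \<phi> i \<in> carrier R) \<and> (\<forall>i. i \<notin> I \<longrightarrow> \<phi> i = \<zero>\<^bsub>R\<^esub>)
                  \<and> finite {i. \<phi> i \<noteq> \<zero>\<^bsub>R\<^esub>}},
      mult = undefined,
      one = undefined,
      zero = (\<lambda>i. \<zero>\<^bsub>R\<^esub>),
      add = (\<lambda>\<phi> \<psi> i. \<phi> i \<oplus>\<^bsub>R\<^esub> \<psi> i),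
      smult = (\<lambda>r \<phi> i. r \<otimes>\<^bsub>R\<^esub> \<phi> i) \<rparr>"

text \<open>
  Projective means direct summand of a free module. Index sets inside the type of the elements
  of \<open>M\<close> are sufficient, because \<open>M\<close> is a quotient of the free module on \<open>carrier M\<close>.
\<close>

definition projective_module :: "('a, 'r) ring_scheme \<Rightarrow> ('a, 'b, 'm) module_scheme \<Rightarrow> bool" where
  "projective_module R M \<longleftrightarrow>
    (\<exists>(I :: 'b set) \<iota> \<pi>. \<iota> \<in> linear_maps R M (free_module R I)
       \<and> \<pi> \<in> linear_maps R (free_module R I) M
       \<and> (\<forall>m \<in> carrier M. \<pi> (\<iota> m) = m))"


section \<open>Support varieties\<close>

text \<open>
  The restricted enveloping algebra \<open>k[x]/(x\<^sup>p)\<close> of the span of \<open>x \<noteq> 0\<close> with \<open>x\<^sup>[\<^sup>p\<^sup>] = 0\<close>,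
  on the polynomials of degree less than \<open>p\<close>.
\<close>

definition trunc_poly_ring :: "('k::field poly) ring" where
  "trunc_poly_ring =
    \<lparr> carrier = {q. degree q < CHAR('k)},
      mult = (\<lambda>q r. (q * r) mod monom 1 CHAR('k)),
      one = 1,
      zero = 0,
      add = (+) \<rparr>"

definition restrict_to :: "('k::field, 'v) B_module \<Rightarrow> 'k ^ 2 ^ 2 \<Rightarrow> ('k poly, 'v) module" where
  "restrict_to M x =
    \<lparr> carrier = carrier M,
      mult = undefined,
      one = undefined,
      zero = \<zero>\<^bsub>M\<^esub>,
      add = add M,
      smult = (\<lambda>q v. finsum M (\<lambda>i. coeff q i \<odot>\<^bsub>M\<^esub> ((lie_act M x) ^^ i) v) {..degree q}) \<rparr>"

text \<open>
  \<open>\<V>(M)\<close> for the first Frobenius kernel of \<open>B\<close>, as a subset of \<open>Lie(B)\<close> by means of the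
  identification of the spectrum of the cohomology ring with \<open>nullcone_b\<close>, i.e. the rank variety.
\<close>

definition support_variety_B1 :: "('k::field, 'v) B_module \<Rightarrow> ('k ^ 2 ^ 2) set" where
  "support_variety_B1 M =
    {x \<in> nullcone_b. \<not> projective_module trunc_poly_ring (restrict_to M x)} \<union> {0}"

end

theory Submission
  imports Defs
begin

text \<open>
  The nullcone of \<open>\<bb>\<close> is the line \<open>\<uu>\<close>, so only one question has to be answered: for which weights
  \<open>n\<close> is \<open>H\<^sup>0(w, n)\<close> projective over the algebra \<open>k[X]/(X\<^sup>p)\<close> generated by a nonzero
  \<open>x \<in> \<uu>\<close>?

  A section over \<open>X(w)\<close> is determined by the second column \<open>(y, z)\<close> of a matrix, because right
  translation by the unipotent radical fixes this column, and the torus makes the section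
  homogeneous of degree \<open>n\<close> in it. Over \<open>X(s)\<close> the sections are therefore the binary forms of
  degree \<open>n\<close>; over the point \<open>X(e)\<close> the coordinate \<open>y\<close> vanishes and only the multiples of \<open>z\<^sup>n\<close>
  remain. In both cases \<open>H\<^sup>0(w, n)\<close> is a copy of the polynomials of degree at most \<open>N\<close> in one
  variable, with \<open>N = n\<close> for \<open>s\<close> and \<open>N = 0\<close> for \<open>e\<close> (\<open>form_section_bij\<close>). A matrix
  \<open>1 + t x\<close> with lower left entry \<open>t c\<close> moves \<open>z\<close> to \<open>z - t c y\<close>, so \<open>x\<close> acts as \<open>-c\<close> times the
  derivative (\<open>lie_act_form_section\<close>).

  It remains to see when the derivative turns the polynomials of degree at most \<open>N\<close> into a
  projective \<open>k[X]/(X\<^sup>p)\<close>-module. In characteristic \<open>p\<close> the monomials break up into the chains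
  \<open>Z\<^bsup>mp + p - 1\<^esup> \<mapsto> \<dots> \<mapsto> Z\<^bsup>mp\<^esup> \<mapsto> 0\<close>, up to nonzero scalars. If \<open>p\<close> divides \<open>N + 1\<close>, all
  chains are complete and the module is free (\<open>dvd_imp_projective\<close>). Otherwise the last chain is
  too short, and its bottom lies in the kernel of \<open>X\<close> but not in the image of \<open>X\<^bsup>p - 1\<^esup>\<close>, which
  is impossible in a projective module (\<open>projective_imp_dvd\<close>). So projectivity means that \<open>p\<close>
  divides \<open>n + 1\<close> for \<open>s\<close>, and that \<open>p\<close> divides \<open>1\<close>, which is absurd, for \<open>e\<close>.
\<close>

(* smult is to mean scaling of polynomials, and $ selection of matrix entries. *)
hide_const (open) module.smult
no_notation fps_nth (infixl "$" 75)


section \<open>Polynomials as a module over the truncated polynomial ring\<close>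

definition scaled_deriv :: "'k::field \<Rightarrow> 'k poly \<Rightarrow> 'k poly" where
  "scaled_deriv c P = smult c (pderiv P)"

lemma coeff_scaled_deriv_funpow:
  "coeff ((scaled_deriv c ^^ i) P) e = c ^ i * pochhammer (of_nat (Suc e)) i * coeff P (e + i)"
proof -
  have "(scaled_deriv c ^^ i) P = smult (c ^ i) ((pderiv ^^ i) P)"
    by (induction i) (simp_all add: scaled_deriv_def pderiv_smult)
  then show ?thesis
    by (simp add: coeff_higher_pderiv mult.assoc)
qed

text \<open>
  The \<open>i\<close>-th derivative multiplies coefficients by products of \<open>i\<close> consecutive integers, which
  are divisible by \<open>i!\<close> and hence by \<open>p\<close> once \<open>i \<ge> p\<close>.
\<close>

lemma scaled_deriv_funpow_eq_0:
  fixes P :: "'k::field poly"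
  assumes "CHAR('k) \<le> i" "CHAR('k) > 0"
  shows "(scaled_deriv c ^^ i) P = 0"
proof (rule poly_eqI)
  fix e
  have "int (fact i) dvd int (pochhammer (Suc e) i)"
    using fact_dvd_pochhammer[of i "int (Suc e)"] by (simp add: pochhammer_of_nat del: of_nat_Suc)
  then have "fact i dvd pochhammer (Suc e) i"
    by (simp only: int_dvd_int_iff)
  moreover have "CHAR('k) dvd (fact i :: nat)"
    using assms by (intro dvd_fact) auto
  ultimately have "of_nat (pochhammer (Suc e) i) = (0 :: 'k)"
    by (simp only: of_nat_eq_0_iff_char_dvd) (rule dvd_trans)
  then show "coeff ((scaled_deriv c ^^ i) P) e = coeff 0 e"
    unfolding coeff_scaled_deriv_funpow pochhammer_of_nat by simp
qed

lemma scaled_deriv_add: "scaled_deriv c (P + Q) = scaled_deriv c P + scaled_deriv c Q"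
  by (simp add: scaled_deriv_def pderiv_add smult_add_right)

lemma scaled_deriv_funpow_add:
  "(scaled_deriv c ^^ i) (P + Q) = (scaled_deriv c ^^ i) P + (scaled_deriv c ^^ i) Q"
  by (induction i) (simp_all add: scaled_deriv_add)

lemma scaled_deriv_smult: "scaled_deriv c (smult a P) = smult a (scaled_deriv c P)"
  by (simp add: scaled_deriv_def pderiv_smult mult.commute)

lemma scaled_deriv_funpow_smult:
  "(scaled_deriv c ^^ i) (smult a P) = smult a ((scaled_deriv c ^^ i) P)"
  by (induction i) (simp_all add: scaled_deriv_smult)

lemma scaled_deriv_funpow_0 [simp]: "(scaled_deriv c ^^ i) 0 = 0"
  by (induction i) (simp_all add: scaled_deriv_def)

lemma scaled_deriv_funpow_sum:
  "(scaled_deriv c ^^ i) (\<Sum>j\<in>A. F j) = (\<Sum>j\<in>A. (scaled_deriv c ^^ i) (F j))"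
  by (induction A rule: infinite_finite_induct) (simp_all add: scaled_deriv_funpow_add)

lemma smult_sum_right: "smult a (\<Sum>j\<in>A. F j) = (\<Sum>j\<in>A. smult a (F j))"
  by (induction A rule: infinite_finite_induct) (simp_all add: smult_add_right)

lemma degree_scaled_deriv_funpow: "degree ((scaled_deriv c ^^ i) P) \<le> degree P"
  by (rule degree_le) (simp add: coeff_scaled_deriv_funpow coeff_eq_0)

text \<open>
  Substitution of the derivation into a polynomial. The sum stops at \<open>p\<close>, since by nilpotency the
  higher powers of the derivation vanish; a bound that is independent of \<open>q\<close> makes linearity
  in \<open>q\<close> immediate.
\<close>

definition poly_act :: "'k::field \<Rightarrow> 'k poly \<Rightarrow> 'k poly \<Rightarrow> 'k poly" where
  "poly_act c q P = (\<Sum>i<CHAR('k). smult (coeff q i) ((scaled_deriv c ^^ i) P))"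

lemma degree_poly_act: "degree (poly_act c q P) \<le> degree P"
  unfolding poly_act_def
  by (intro degree_sum_le order.trans[OF degree_smult_le] degree_scaled_deriv_funpow) auto

lemma poly_act_add_left: "poly_act c (q + r) P = poly_act c q P + poly_act c r P"
  by (simp add: poly_act_def smult_add_left sum.distrib)

lemma poly_act_monom:
  fixes P :: "'k::field poly"
  assumes "i < CHAR('k)"
  shows "poly_act c (monom 1 i) P = (scaled_deriv c ^^ i) P"
proof -
  have "poly_act c (monom 1 i) P =
      (\<Sum>j<CHAR('k). if j = i then (scaled_deriv c ^^ i) P else 0)"
    unfolding poly_act_def by (rule sum.cong) (auto simp: coeff_monom)
  then show ?thesis
    using assms by simp
qed

lemma poly_act_sum_right: "poly_act c q (\<Sum>j\<in>A. F j) = (\<Sum>j\<in>A. poly_act c q (F j))"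
  unfolding poly_act_def scaled_deriv_funpow_sum smult_sum_right by (rule sum.swap)

lemma coeff_mod_monom:
  fixes q :: "'k::field poly"
  assumes "i < n"
  shows "coeff (q mod monom 1 n) i = coeff q i"
proof -
  have "coeff q i = coeff (q mod monom 1 n + monom 1 n * (q div monom 1 n)) i"
    by (simp only: mod_mult_div_eq)
  then show ?thesis
    using assms by (simp only: coeff_add coeff_monom_mult) simp
qed

lemma degree_mod_monom:
  fixes q :: "'k::field poly"
  assumes "n > 0"
  shows "degree (q mod monom 1 n) < n"
  using degree_mod_less[of "monom 1 n" q] assms by (auto simp: degree_monom_eq)

text \<open>
  The terms that reduction modulo \<open>X\<^sup>p\<close> removes act by zero, because the derivation is nilpotent
  of order \<open>p\<close>.
\<close>

lemma poly_act_mult: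
  fixes P :: "'k::field poly"
  assumes "CHAR('k) > 0"
  shows "poly_act c ((q * r) mod monom 1 CHAR('k)) P = poly_act c q (poly_act c r P)"
proof -
  let ?p = "CHAR('k)"
  let ?t = "\<lambda>i j. smult (coeff q i * coeff r j) ((scaled_deriv c ^^ (i + j)) P)"
  have in_triangle: "i + j < ?p" if "?t i j \<noteq> 0" for i j
    using that assms scaled_deriv_funpow_eq_0[of "i + j" c P] by (auto simp: not_less[symmetric])
  have "poly_act c ((q * r) mod monom 1 ?p) P = (\<Sum>k<?p. \<Sum>i\<le>k. ?t i (k - i))"
    unfolding poly_act_def
    by (rule sum.cong) (simp_all add: coeff_mod_monom coeff_mult smult_sum)
  also have "\<dots> = (\<Sum>(i, j)\<in>{(i, j). i + j < ?p}. ?t i j)"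
    by (rule sum.triangle_reindex[symmetric])
  also have "\<dots> = (\<Sum>(i, j)\<in>{..<?p} \<times> {..<?p}. ?t i j)"
    by (rule sum.mono_neutral_left) (auto intro: in_triangle simp del: smult_eq_0_iff)
  also have "\<dots> = (\<Sum>i<?p. \<Sum>j<?p. ?t i j)"
    by (rule sum.cartesian_product[symmetric])
  also have "\<dots> = poly_act c q (poly_act c r P)"
    by (simp add: poly_act_def scaled_deriv_funpow_sum scaled_deriv_funpow_smult smult_sum_right
        funpow_add sum_distrib_left)
  finally show ?thesis .
qed


section \<open>Projectivity criterion for the derivation\<close>

text \<open>
  Both spaces of sections are polynomials of bounded degree on which \<open>x\<close> acts by a multiple of the
  derivative; only the bound differs. The criterion for projectivity is therefore proved
  once, for any \<open>B\<close>-module with such a parametrization \<open>\<Phi>\<close>.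
\<close>

locale derivation_model =
  fixes M :: "('k::field, 'v) B_module" and x :: "'k ^ 2 ^ 2"
    and \<Phi> :: "'k poly \<Rightarrow> 'v" and N :: nat and c :: 'k
  assumes char_pos: "CHAR('k) > 0"
    and monoid: "abelian_monoid M"
    and bij: "bij_betw \<Phi> {P. degree P \<le> N} (carrier M)"
    and \<Phi>_add: "\<And>P Q. degree P \<le> N \<Longrightarrow> degree Q \<le> N \<Longrightarrow> \<Phi> (P + Q) = \<Phi> P \<oplus>\<^bsub>M\<^esub> \<Phi> Q"
    and \<Phi>_zero: "\<Phi> 0 = \<zero>\<^bsub>M\<^esub>"
    and \<Phi>_smult: "\<And>a P. degree P \<le> N \<Longrightarrow> \<Phi> (smult a P) = a \<odot>\<^bsub>M\<^esub> \<Phi> P"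
    and lie: "\<And>P. degree P \<le> N \<Longrightarrow> lie_act M x (\<Phi> P) = \<Phi> (scaled_deriv c P)"
    and c_nonzero: "c \<noteq> 0"
begin

lemma \<Phi>_in: "degree P \<le> N \<Longrightarrow> \<Phi> P \<in> carrier M"
  using bij by (auto simp: bij_betw_def)

lemma \<Phi>_inject: "degree P \<le> N \<Longrightarrow> degree Q \<le> N \<Longrightarrow> \<Phi> P = \<Phi> Q \<longleftrightarrow> P = Q"
  using bij by (auto simp: bij_betw_def inj_on_def)

lemma carrier_cases:
  assumes "m \<in> carrier M"
  obtains P where "degree P \<le> N" "m = \<Phi> P"
  using assms bij by (auto simp: bij_betw_def)

lemma degree_funpow: "degree P \<le> N \<Longrightarrow> degree ((scaled_deriv c ^^ i) P) \<le> N"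
  using degree_scaled_deriv_funpow order.trans by blast

lemma degree_act: "degree P \<le> N \<Longrightarrow> degree (poly_act c q P) \<le> N"
  using degree_poly_act order.trans by blast

lemma lie_act_funpow:
  assumes "degree P \<le> N"
  shows "(lie_act M x ^^ i) (\<Phi> P) = \<Phi> ((scaled_deriv c ^^ i) P)"
  by (induction i) (simp_all add: lie degree_funpow assms)

lemma finsum_\<Phi>:
  assumes "finite A" "\<And>i. i \<in> A \<Longrightarrow> degree (F i) \<le> N"
  shows "finsum M (\<lambda>i. \<Phi> (F i)) A = \<Phi> (\<Sum>i\<in>A. F i)"
  using assms
proof (induction A rule: finite_induct)
  case empty
  then show ?case
    by (simp add: \<Phi>_zero abelian_monoid.finsum_empty[OF monoid])
next
  case (insert i A)
  then have "finsum M (\<lambda>i. \<Phi> (F i)) (insert i A) = \<Phi> (F i) \<oplus>\<^bsub>M\<^esub> finsum M (\<lambda>i. \<Phi> (F i)) A"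
    by (intro abelian_monoid.finsum_insert[OF monoid]) (auto intro: \<Phi>_in)
  also have "\<dots> = \<Phi> (F i + (\<Sum>i\<in>A. F i))"
    using insert by (subst \<Phi>_add) (auto intro: degree_sum_le)
  finally show ?case
    using insert by simp
qed

lemma smult_restrict:
  assumes "degree P \<le> N" "degree q < CHAR('k)"
  shows "q \<odot>\<^bsub>restrict_to M x\<^esub> \<Phi> P = \<Phi> (poly_act c q P)"
proof -
  have "q \<odot>\<^bsub>restrict_to M x\<^esub> \<Phi> P =
      finsum M (\<lambda>i. \<Phi> (smult (coeff q i) ((scaled_deriv c ^^ i) P))) {..degree q}"
    using assms by (simp add: restrict_to_def lie_act_funpow \<Phi>_smult degree_funpow)
  also have "\<dots> = \<Phi> (\<Sum>i\<le>degree q. smult (coeff q i) ((scaled_deriv c ^^ i) P))"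
    by (rule finsum_\<Phi>)
      (auto intro: order.trans[OF degree_smult_le] degree_funpow assms)
  also have "(\<Sum>i\<le>degree q. smult (coeff q i) ((scaled_deriv c ^^ i) P)) = poly_act c q P"
    unfolding poly_act_def using assms
    by (intro sum.mono_neutral_left) (auto simp: coeff_eq_0)
  finally show ?thesis .
qed

text \<open>
  In a free module over \<open>k[X]/(X\<^sup>p)\<close> the kernel of \<open>X\<close> is the image of \<open>X\<^bsup>p - 1\<^esup>\<close>, and direct
  summands inherit this. Suppose that \<open>p\<close> does not divide \<open>N + 1\<close>, and let \<open>m\<close> be the largest
  multiple of \<open>p\<close> up to \<open>N\<close>. The monomial of degree \<open>m\<close> is killed by the derivation, but it
  could only be reached by \<open>p - 1\<close> derivations from degree \<open>m + p - 1\<close>, which exceeds \<open>N\<close>.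
\<close>

lemma projective_imp_dvd:
  assumes "projective_module trunc_poly_ring (restrict_to M x)"
  shows "CHAR('k) dvd N + 1"
proof (rule ccontr)
  assume ndvd: "\<not> CHAR('k) dvd N + 1"
  define p where "p = CHAR('k)"
  have p2: "p \<ge> 2"
    using char_pos CHAR_not_1[where ?'a = 'k] unfolding p_def by linarith
  let ?R = "trunc_poly_ring :: 'k poly ring" and ?M = "restrict_to M x"
  obtain I :: "'v set" and \<iota> \<pi> where
    \<iota>: "\<iota> \<in> linear_maps ?R ?M (free_module ?R I)" and
    \<pi>: "\<pi> \<in> linear_maps ?R (free_module ?R I) ?M" and
    \<pi>\<iota>: "\<And>v. v \<in> carrier ?M \<Longrightarrow> \<pi> (\<iota> v) = v"
    using assms unfolding projective_module_def by blast
  have carrierM: "carrier ?M = carrier M"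
    by (simp add: restrict_to_def)
  have X_in: "monom 1 i \<in> carrier ?R" if "i < p" for i
    using that by (simp add: trunc_poly_ring_def p_def degree_monom_eq)

  define m where "m = N div p * p"
  define v where "v = \<Phi> (monom 1 m)"
  have deg_v: "degree (monom (1::'k) m) \<le> N"
    by (simp add: degree_monom_eq m_def)
  have v_in: "v \<in> carrier ?M"
    using \<Phi>_in[OF deg_v] by (simp add: carrierM v_def)
  have m_zero: "of_nat m = (0 :: 'k)"
    by (simp add: of_nat_eq_0_iff_char_dvd m_def p_def)

  have "scaled_deriv c (monom 1 m) = 0"
    by (simp add: scaled_deriv_def pderiv_monom m_zero)
  then have Xv: "monom 1 1 \<odot>\<^bsub>?M\<^esub> v = \<zero>\<^bsub>M\<^esub>"
    using p2 smult_restrict[OF deg_v, of "monom 1 1"]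
    by (simp add: v_def poly_act_monom \<Phi>_zero p_def degree_monom_eq)

  define \<phi> where "\<phi> = \<iota> v"
  have \<phi>_in: "\<phi> \<in> carrier (free_module ?R I)"
    using \<iota> v_in by (auto simp: linear_maps_def \<phi>_def)
  have zero_in: "\<zero>\<^bsub>M\<^esub> \<in> carrier ?M"
    by (simp add: carrierM abelian_monoid.zero_closed[OF monoid])
  have "\<iota> \<zero>\<^bsub>M\<^esub> = \<iota> (\<zero>\<^bsub>M\<^esub> \<oplus>\<^bsub>?M\<^esub> \<zero>\<^bsub>M\<^esub>)"
    by (simp add: restrict_to_def abelian_monoid.l_zero[OF monoid] abelian_monoid.zero_closed[OF monoid])
  also have "\<dots> = (\<lambda>i. \<iota> \<zero>\<^bsub>M\<^esub> i + \<iota> \<zero>\<^bsub>M\<^esub> i)"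
    using \<iota> zero_in by (simp add: linear_maps_def free_module_def trunc_poly_ring_def)
  finally have \<iota>_zero: "\<iota> \<zero>\<^bsub>M\<^esub> i = 0" for i
    by (metis add_cancel_right_right)
  have "\<iota> (monom 1 1 \<odot>\<^bsub>?M\<^esub> v) = monom 1 1 \<odot>\<^bsub>free_module ?R I\<^esub> \<phi>"
    using \<iota> v_in X_in[of 1] p2 by (simp add: linear_maps_def \<phi>_def)
  then have X\<phi>: "(monom 1 1 * \<phi> i) mod monom 1 p = 0" for i
    unfolding Xv using \<iota>_zero by (simp add: free_module_def trunc_poly_ring_def p_def fun_eq_iff)
  have deg_\<phi>: "degree (\<phi> i) < p" for i
    using \<phi>_in p2 by (cases "i \<in> I") (auto simp: free_module_def trunc_poly_ring_def p_def)
  have \<phi>_coeff: "coeff (\<phi> i) j = 0" if "Suc j < p" for i j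
    using coeff_mod_monom[of "Suc j" p "monom 1 1 * \<phi> i"] that
    by (simp only: X\<phi>) (simp add: coeff_monom_mult)

  \<comment> \<open>As \<open>X\<close> kills \<open>\<phi>\<close>, only the top coefficient of each coordinate survives; dividing it by
    \<open>X\<^bsup>p - 1\<^esup>\<close> gives a preimage.\<close>
  define \<psi> where "\<psi> = (\<lambda>i. [:coeff (\<phi> i) (p - 1):])"
  have "{i. \<psi> i \<noteq> 0} \<subseteq> {i. \<phi> i \<noteq> 0}"
    by (auto simp: \<psi>_def)
  then have \<psi>_in: "\<psi> \<in> carrier (free_module ?R I)"
    using \<phi>_in p2 finite_subset
    by (auto simp: free_module_def trunc_poly_ring_def \<psi>_def p_def)
  have "\<phi> = monom 1 (p - 1) \<odot>\<^bsub>free_module ?R I\<^esub> \<psi>"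
  proof
    fix i
    have "coeff (monom 1 (p - 1) * \<psi> i) j = coeff (\<phi> i) j" for j
      using \<phi>_coeff[of j i] coeff_eq_0[of "\<phi> i" j] deg_\<phi>[of i]
      by (cases "j = p - 1"; cases "j < p - 1")
         (auto simp: \<psi>_def coeff_monom_mult coeff_pCons split: nat.splits)
    then have "monom 1 (p - 1) * \<psi> i = \<phi> i"
      by (rule poly_eqI)
    then show "\<phi> i = (monom 1 (p - 1) \<odot>\<^bsub>free_module ?R I\<^esub> \<psi>) i"
      using deg_\<phi>[of i] by (simp add: free_module_def trunc_poly_ring_def mod_poly_less degree_monom_eq p_def)
  qed
  then have "v = monom 1 (p - 1) \<odot>\<^bsub>?M\<^esub> \<pi> \<psi>"
    using \<pi> \<psi>_in X_in[of "p - 1"] p2 \<pi>\<iota>[OF v_in] by (simp add: linear_maps_def \<phi>_def)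
  moreover have "\<pi> \<psi> \<in> carrier M"
    using \<pi> \<psi>_in by (auto simp: linear_maps_def carrierM)
  then obtain Q where Q: "degree Q \<le> N" "\<pi> \<psi> = \<Phi> Q"
    by (rule carrier_cases)
  ultimately have "\<Phi> (monom 1 m) = \<Phi> ((scaled_deriv c ^^ (p - 1)) Q)"
    using p2 by (simp add: v_def smult_restrict poly_act_monom degree_monom_eq p_def)
  then have "monom 1 m = (scaled_deriv c ^^ (p - 1)) Q"
    using \<Phi>_inject deg_v Q degree_funpow by simp
  then have "coeff ((scaled_deriv c ^^ (p - 1)) Q) m = 1"
    by (metis coeff_monom)
  moreover have "coeff Q (m + (p - 1)) = 0"
  proof (rule coeff_eq_0)
    have "N mod p \<noteq> p - 1"
    proof
      assume "N mod p = p - 1"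
      then have "Suc N mod p = 0"
        using p2 by (simp add: mod_Suc)
      then show False
        using ndvd by (simp add: p_def dvd_eq_mod_eq_0)
    qed
    moreover have "N mod p < p"
      using p2 by simp
    ultimately have "N mod p < p - 1"
      by linarith
    then have "N < m + (p - 1)"
      using div_mult_mod_eq[of N p] unfolding m_def by linarith
    then show "degree Q < m + (p - 1)"
      using Q by linarith
  qed
  ultimately show False
    by (simp add: coeff_scaled_deriv_funpow)
qed

text \<open>
  The algebra \<open>k[X]/(X\<^sup>p)\<close> is a Frobenius algebra: a \<open>k\<close>-linear functional \<open>\<lambda>\<close> on a module
  extends to the module homomorphism \<open>v \<mapsto> \<Sum>\<^sub>i \<lambda>(X\<^bsup>p - 1 - i\<^esup> v) X\<^sup>i\<close> into the algebra. Here \<open>\<lambda>\<close>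
  reads off the coefficient in degree \<open>m p\<close>, the bottom of the \<open>m\<close>-th chain. The normalization
  is the scalar by which \<open>p - 1\<close> derivations take the top of a chain to its bottom.
\<close>

definition coords :: "'k poly \<Rightarrow> nat \<Rightarrow> 'k poly" where
  "coords P m = (\<Sum>i<CHAR('k). monom
     (coeff ((scaled_deriv c ^^ (CHAR('k) - 1 - i)) P) (m * CHAR('k))
       / (c ^ (CHAR('k) - 1) * of_nat (fact (CHAR('k) - 1)))) i)"

definition chain_top :: "nat \<Rightarrow> 'k poly" where
  "chain_top m = monom 1 (m * CHAR('k) + (CHAR('k) - 1))"

lemma coeff_coords:
  "coeff (coords P m) i = (if i < CHAR('k) then
     coeff ((scaled_deriv c ^^ (CHAR('k) - 1 - i)) P) (m * CHAR('k))
       / (c ^ (CHAR('k) - 1) * of_nat (fact (CHAR('k) - 1))) else 0)"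
  by (simp add: coords_def coeff_sum coeff_monom)

lemma degree_coords: "degree (coords P m) < CHAR('k)"
proof -
  have "degree (coords P m) \<le> CHAR('k) - 1"
    using char_pos by (intro degree_le) (auto simp: coeff_coords)
  then show ?thesis
    using char_pos by linarith
qed

lemma coords_add: "coords (P + Q) m = coords P m + coords Q m"
  by (rule poly_eqI) (simp add: coeff_coords scaled_deriv_funpow_add add_divide_distrib)

lemma coords_act:
  assumes "degree q < CHAR('k)"
  shows "coords (poly_act c q P) m = (q * coords P m) mod monom 1 CHAR('k)"
proof (rule poly_eqI)
  fix i
  let ?p = "CHAR('k)" and ?\<gamma> = "c ^ (CHAR('k) - 1) * of_nat (fact (CHAR('k) - 1))"
  let ?a = "\<lambda>j. coeff ((scaled_deriv c ^^ j) P) (m * ?p)"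
  show "coeff (coords (poly_act c q P) m) i = coeff ((q * coords P m) mod monom 1 ?p) i"
  proof (cases "i < ?p")
    case True
    have "coeff (coords (poly_act c q P) m) i = (\<Sum>j<?p. coeff q j * ?a (?p - 1 - i + j)) / ?\<gamma>"
      using True
      by (simp only: coeff_coords if_True poly_act_def scaled_deriv_funpow_sum
          scaled_deriv_funpow_smult coeff_sum coeff_smult funpow_add o_apply)
    also have "(\<Sum>j<?p. coeff q j * ?a (?p - 1 - i + j)) = (\<Sum>j\<le>i. coeff q j * ?a (?p - 1 - i + j))"
    proof (rule sum.mono_neutral_right)
      show "\<forall>j \<in> {..<?p} - {..i}. coeff q j * ?a (?p - 1 - i + j) = 0"
        using True by (auto simp: scaled_deriv_funpow_eq_0)
    qed (use True in auto)
    also have "\<dots> = (\<Sum>j\<le>i. coeff q j * ?a (?p - 1 - (i - j)))"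
      using True by (intro sum.cong) (auto intro!: arg_cong[where f = ?a])
    also have "\<dots> / ?\<gamma> = (\<Sum>j\<le>i. coeff q j * coeff (coords P m) (i - j))"
      using True by (subst sum_divide_distrib, intro sum.cong) (auto simp: coeff_coords)
    also have "\<dots> = coeff ((q * coords P m) mod monom 1 ?p) i"
      using True by (simp add: coeff_mod_monom coeff_mult)
    finally show ?thesis .
  next
    case False
    then show ?thesis
      using degree_mod_monom[OF char_pos, of "q * coords P m"]
      by (simp add: coeff_coords coeff_eq_0)
  qed
qed

lemma char_fact_nonzero: "(of_nat (fact (CHAR('k) - 1)) :: 'k) \<noteq> 0"
proof -
  have "prime CHAR('k)"
    using char_pos by (rule prime_CHAR_semidom)
  then have "\<not> CHAR('k) dvd fact (CHAR('k) - 1)"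
    using char_pos by (simp add: prime_dvd_fact_iff)
  then show ?thesis
    by (simp only: of_nat_eq_0_iff_char_dvd not_False_eq_True)
qed

lemma coeff_funpow_chain_top:
  "coeff ((scaled_deriv c ^^ i) (chain_top m)) e =
    (if e + i = m * CHAR('k) + (CHAR('k) - 1) then c ^ i * pochhammer (of_nat (Suc e)) i else 0)"
  by (simp add: coeff_scaled_deriv_funpow chain_top_def coeff_monom)

text \<open>
  The coefficient of \<open>P\<close> in degree \<open>e = m p + k\<close> is recovered in two stages: \<open>k\<close> derivations
  transport it to the bottom of the \<open>m\<close>-th chain, and \<open>p - 1 - k\<close> derivations bring the top of
  that chain down to degree \<open>e\<close>. The two scalars multiply to the one of all \<open>p - 1\<close> steps,
  which \<open>coords\<close> divides out.
\<close>

lemma coords_reconstruct: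
  assumes "N + 1 = CHAR('k) * r" "degree P \<le> N"
  shows "(\<Sum>m<r. poly_act c (coords P m) (chain_top m)) = P"
proof (rule poly_eqI)
  fix e
  define p where "p = CHAR('k)"
  define \<gamma> where "\<gamma> = c ^ (p - 1) * of_nat (fact (p - 1))"
  have p: "p > 0"
    using char_pos by (simp add: p_def)
  have \<gamma>: "\<gamma> \<noteq> 0"
    using c_nonzero char_fact_nonzero by (simp add: \<gamma>_def p_def)
  define k m0 where "k = e mod p" and "m0 = e div p"
  have e: "e = m0 * p + k" and k: "k < p"
    using p by (auto simp: k_def m0_def)
  let ?t = "\<lambda>m i. coeff (coords P m) i * coeff ((scaled_deriv c ^^ i) (chain_top m)) e"
  have t: "?t m i = (if m = m0 \<and> i = p - 1 - k then coeff P e else 0)" if "i < p" for m i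
  proof (cases "e + i = m * p + (p - 1)")
    case True
    have "m = (m * p + (p - 1)) div p"
      using p by (intro div_nat_eqI[symmetric]) (simp_all add: mult.commute)
    also have "\<dots> = m0"
    proof (rule div_nat_eqI)
      have "m0 * p < m * p + p"
        using True e that p by linarith
      then have "m0 * p < Suc m * p"
        by simp
      then have "m0 \<le> m"
        using p by (metis less_Suc_eq_le mult_less_cancel2)
      then show "p * m0 \<le> m * p + (p - 1)"
        by (metis mult.commute mult_le_mono1 trans_le_add1)
      have "m * p < m0 * p + p"
        using True e that k by linarith
      then have "m * p < Suc m0 * p"
        by simp
      then have "m \<le> m0"
        using p by (metis less_Suc_eq_le mult_less_cancel2)
      then have "m * p \<le> m0 * p"
        by simp
      moreover have "p * Suc m0 = m0 * p + p"
        by simp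
      ultimately show "m * p + (p - 1) < p * Suc m0"
        using p by linarith
    qed
    finally have m: "m = m0" .
    have "k + i = p - 1"
      using True e m by simp
    then have i: "i = p - 1 - k" and k': "p - 1 - i = k"
      by linarith+
    have m_zero: "of_nat (m0 * p) = (0 :: 'k)"
      by (simp add: p_def)
    have poch: "pochhammer (of_nat (Suc (m0 * p))) k * pochhammer (of_nat (Suc e)) (p - 1 - k)
        = (of_nat (fact (p - 1)) :: 'k)"
    proof -
      have 1: "of_nat (Suc (m0 * p)) = (1 :: 'k)" "of_nat (Suc e) = 1 + (of_nat k :: 'k)"
        using m_zero by (simp_all add: e del: of_nat_mult)
      have "of_nat (fact (p - 1)) = (pochhammer 1 (p - 1) :: 'k)"
        using pochhammer_of_nat[of 1 "p - 1", where ?'a = 'k]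
        by (simp add: pochhammer_fact[where ?'a = nat])
      then show ?thesis
        unfolding 1 using k pochhammer_product[of k "p - 1" "1 :: 'k"] by simp
    qed
    have "?t m i = c ^ k * c ^ (p - 1 - k) *
        (pochhammer (of_nat (Suc (m0 * p))) k * pochhammer (of_nat (Suc e)) (p - 1 - k)) *
        coeff P e / \<gamma>"
      unfolding coeff_coords coeff_funpow_chain_top
      unfolding coeff_scaled_deriv_funpow
      using that True k' i m e by (simp add: p_def[symmetric] \<gamma>_def)
    also have "c ^ k * c ^ (p - 1 - k) = c ^ (p - 1)"
      using k by (simp add: power_add[symmetric])
    also have "c ^ (p - 1) * (pochhammer (of_nat (Suc (m0 * p))) k *
        pochhammer (of_nat (Suc e)) (p - 1 - k)) * coeff P e / \<gamma> = coeff P e"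
      unfolding poch \<gamma>_def[symmetric] using \<gamma> by simp
    finally show ?thesis
      using m i by simp
  next
    case False
    have "e + (p - 1 - k) = m0 * p + (p - 1)"
      using e k by linarith
    with False have "\<not> (m = m0 \<and> i = p - 1 - k)"
      by blast
    then show ?thesis
      unfolding if_not_P[OF \<open>\<not> (m = m0 \<and> i = p - 1 - k)\<close>]
      using False by (simp add: coeff_funpow_chain_top p_def)
  qed
  have "coeff (\<Sum>m<r. poly_act c (coords P m) (chain_top m)) e = (\<Sum>m<r. \<Sum>i<p. ?t m i)"
    by (simp add: poly_act_def coeff_sum p_def)
  also have "\<dots> = (\<Sum>m<r. \<Sum>i<p. if m = m0 \<and> i = p - 1 - k then coeff P e else 0)"
    by (intro sum.cong) (auto simp: t)
  also have "\<dots> = (\<Sum>m<r. if m = m0 then coeff P e else 0)"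
    using p by (intro sum.cong) auto
  also have "\<dots> = (if m0 < r then coeff P e else 0)"
    by simp
  also have "\<dots> = coeff P e"
  proof (cases "m0 < r")
    case False
    then have "r * p \<le> m0 * p"
      by simp
    moreover have "N + 1 = r * p"
      using assms(1) by (simp add: p_def mult.commute)
    ultimately have "N < e"
      using e by linarith
    then show ?thesis
      using assms(2) by (simp add: coeff_eq_0)
  qed simp
  finally show "coeff (\<Sum>m<r. poly_act c (coords P m) (chain_top m)) e = coeff P e" .
qed

text \<open>
  If \<open>N + 1 = p r\<close>, the \<open>r\<close> tops of the chains are a basis over \<open>k[X]/(X\<^sup>p)\<close>. The free module is
  indexed by the sections at these tops, so that the index set lies in the type of the module.
\<close>

lemma dvd_imp_projective:
  assumes "CHAR('k) dvd N + 1"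
  shows "projective_module trunc_poly_ring (restrict_to M x)"
proof -
  obtain r where r: "N + 1 = CHAR('k) * r"
    using assms by (rule dvdE)
  let ?R = "trunc_poly_ring :: 'k poly ring" and ?M = "restrict_to M x"
  define \<Psi> where "\<Psi> = inv_into {P. degree P \<le> N} \<Phi>"
  have \<Psi>\<Phi>: "\<Psi> (\<Phi> P) = P" if "degree P \<le> N" for P
    using bij that by (simp add: \<Psi>_def bij_betw_def)
  have deg_top: "degree (chain_top m) \<le> N" if "m < r" for m
  proof -
    have "Suc m * CHAR('k) \<le> r * CHAR('k)"
      using that by (intro mult_le_mono1) auto
    then have "m * CHAR('k) + (CHAR('k) - 1) \<le> N"
      using r char_pos by (simp add: mult.commute)
    then show ?thesis
      by (simp add: chain_top_def degree_monom_eq)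
  qed
  define gen where "gen = (\<lambda>m. \<Phi> (chain_top m))"
  have "inj_on chain_top {..<r}"
    using char_pos by (intro inj_onI) (simp only: chain_top_def monom_eq_iff' add_right_cancel mult_cancel2, simp)
  then have inj: "inj_on gen {..<r}"
    using deg_top by (auto simp: gen_def inj_on_def \<Phi>_inject)
  define I where "I = gen ` {..<r}"
  define idx where "idx = inv_into {..<r} gen"
  have idx: "idx (gen m) = m" if "m < r" for m
    using inj that by (simp add: idx_def)
  define \<iota> where "\<iota> = (\<lambda>v s. if s \<in> I then coords (\<Psi> v) (idx s) else 0)"
  define \<pi> where "\<pi> = (\<lambda>\<phi>. \<Phi> (\<Sum>m<r. poly_act c (\<phi> (gen m)) (chain_top m)))"
  have deg_sum: "degree (\<Sum>m<r. poly_act c (\<phi> m) (chain_top m)) \<le> N" for \<phi>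
    by (intro degree_sum_le) (auto intro: degree_act deg_top)
  have simps: "carrier ?M = carrier M" "v \<oplus>\<^bsub>?M\<^esub> w = v \<oplus>\<^bsub>M\<^esub> w" for v w
    by (simp_all add: restrict_to_def)

  have "\<iota> \<in> linear_maps ?R ?M (free_module ?R I)"
    unfolding linear_maps_def
  proof (intro CollectI conjI ballI funcsetI)
    fix v assume "v \<in> carrier ?M"
    have "finite {s. \<iota> v s \<noteq> 0}"
      by (rule finite_subset[of _ I]) (auto simp: \<iota>_def I_def)
    then show "\<iota> v \<in> carrier (free_module ?R I)"
      by (auto simp: free_module_def trunc_poly_ring_def \<iota>_def degree_coords)
  next
    fix v w assume "v \<in> carrier ?M" "w \<in> carrier ?M"
    then obtain P Q where P: "degree P \<le> N" "v = \<Phi> P" and Q: "degree Q \<le> N" "w = \<Phi> Q"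
      unfolding simps by (metis carrier_cases)
    then show "\<iota> (v \<oplus>\<^bsub>?M\<^esub> w) = \<iota> v \<oplus>\<^bsub>free_module ?R I\<^esub> \<iota> w"
      by (auto simp: simps \<Phi>_add[symmetric] \<iota>_def \<Psi>\<Phi> degree_add_le coords_add free_module_def
          trunc_poly_ring_def fun_eq_iff)
  next
    fix q v assume q: "q \<in> carrier ?R" and v: "v \<in> carrier ?M"
    from v obtain P where P: "degree P \<le> N" "v = \<Phi> P"
      unfolding simps by (rule carrier_cases)
    have "degree q < CHAR('k)"
      using q by (simp add: trunc_poly_ring_def)
    with P show "\<iota> (q \<odot>\<^bsub>?M\<^esub> v) = q \<odot>\<^bsub>free_module ?R I\<^esub> \<iota> v"
      by (auto simp: smult_restrict \<iota>_def \<Psi>\<Phi> degree_act coords_act free_module_def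
          trunc_poly_ring_def fun_eq_iff)
  qed
  moreover have "\<pi> \<in> linear_maps ?R (free_module ?R I) ?M"
    unfolding linear_maps_def
  proof (intro CollectI conjI ballI funcsetI)
    fix \<phi> assume "\<phi> \<in> carrier (free_module ?R I)"
    show "\<pi> \<phi> \<in> carrier ?M"
      unfolding \<pi>_def simps by (intro \<Phi>_in deg_sum)
  next
    fix \<phi> \<psi> assume "\<phi> \<in> carrier (free_module ?R I)" "\<psi> \<in> carrier (free_module ?R I)"
    show "\<pi> (\<phi> \<oplus>\<^bsub>free_module ?R I\<^esub> \<psi>) = \<pi> \<phi> \<oplus>\<^bsub>?M\<^esub> \<pi> \<psi>"
      by (simp add: \<pi>_def simps \<Phi>_add[symmetric] deg_sum free_module_def trunc_poly_ring_def
          poly_act_add_left sum.distrib)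
  next
    fix q \<phi> assume q: "q \<in> carrier ?R" and "\<phi> \<in> carrier (free_module ?R I)"
    have "degree q < CHAR('k)"
      using q by (simp add: trunc_poly_ring_def)
    then have "q \<odot>\<^bsub>?M\<^esub> \<pi> \<phi> = \<Phi> (poly_act c q (\<Sum>m<r. poly_act c (\<phi> (gen m)) (chain_top m)))"
      unfolding \<pi>_def by (intro smult_restrict deg_sum)
    also have "poly_act c q (\<Sum>m<r. poly_act c (\<phi> (gen m)) (chain_top m)) =
        (\<Sum>m<r. poly_act c q (poly_act c (\<phi> (gen m)) (chain_top m)))"
      by (rule poly_act_sum_right)
    finally show "\<pi> (q \<odot>\<^bsub>free_module ?R I\<^esub> \<phi>) = q \<odot>\<^bsub>?M\<^esub> \<pi> \<phi>"
      by (simp add: \<pi>_def free_module_def trunc_poly_ring_def poly_act_mult[OF char_pos])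
  qed
  moreover have "\<pi> (\<iota> v) = v" if v: "v \<in> carrier ?M" for v
  proof -
    from v obtain P where P: "degree P \<le> N" "v = \<Phi> P"
      unfolding simps by (rule carrier_cases)
    have "\<pi> (\<iota> v) = \<Phi> (\<Sum>m<r. poly_act c (coords P m) (chain_top m))"
      unfolding \<pi>_def by (auto intro!: arg_cong[where f = \<Phi>] sum.cong simp: \<iota>_def I_def idx P \<Psi>\<Phi>)
    also have "\<dots> = v"
      unfolding coords_reconstruct[OF r P(1)] P(2) ..
    finally show ?thesis .
  qed
  ultimately show ?thesis
    unfolding projective_module_def by blast
qed

theorem projective_iff: "projective_module trunc_poly_ring (restrict_to M x) \<longleftrightarrow> CHAR('k) dvd N + 1"
  using projective_imp_dvd dvd_imp_projective by blast

end


section \<open>Polynomials over an algebraically closed field\<close>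

text \<open>
  If the field were finite, \<open>1 + \<Prod>\<^sub>a (X - a)\<close> would have no root.
\<close>

lemma infinite_UNIV_alg_closed: "infinite (UNIV :: 'k::alg_closed_field set)"
proof
  assume fin: "finite (UNIV :: 'k set)"
  define P where "P = (\<Prod>a\<in>(UNIV :: 'k set). [:- a, 1:])"
  have deg: "degree (\<Prod>a\<in>A. [:- a, 1:]) = card A" if "finite A" for A :: "'k set"
    using that
  proof (induction A rule: finite_induct)
    case (insert a A)
    have "(\<Prod>a\<in>A. [:- a, 1:]) \<noteq> 0"
      using insert by simp
    with insert show ?case
      by (simp add: degree_mult_eq del: mult_pCons_left)
  qed simp
  have "degree (P + 1) = card (UNIV :: 'k set)"
    using deg[OF fin] fin finite_UNIV_card_ge_0[OF fin]
    by (subst degree_add_eq_left) (simp_all add: P_def)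
  then obtain x where "poly (P + 1) x = 0"
    using alg_closed_imp_poly_has_root[of "P + 1"] finite_UNIV_card_ge_0[OF fin] by auto
  moreover have "poly P x = 0"
    using fin by (auto simp: P_def poly_prod intro!: prod_zero bexI[of _ x])
  ultimately show False
    by simp
qed

text \<open>
  Omitting the point \<open>0\<close> is what turns an identity on the big cell \<open>g\<^sub>1\<^sub>2 \<noteq> 0\<close> into one on all
  of \<open>SL\<^sub>2\<close>.
\<close>

lemma poly_eqI_nonzero_points:
  fixes P Q :: "'k::alg_closed_field poly"
  assumes "\<And>t. t \<noteq> 0 \<Longrightarrow> poly P t = poly Q t"
  shows "P = Q"
proof (rule ccontr)
  assume "P \<noteq> Q"
  then have "finite {t. poly (P - Q) t = 0}"
    by (intro poly_roots_finite) simp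
  moreover have "UNIV - {0} \<subseteq> {t. poly (P - Q) t = 0}"
    using assms by auto
  ultimately show False
    using infinite_UNIV_alg_closed finite_subset infinite_remove by metis
qed


section \<open>Two by two matrices, the Borel subgroup and its nullcone\<close>

definition mat2 :: "'k \<Rightarrow> 'k \<Rightarrow> 'k \<Rightarrow> 'k \<Rightarrow> 'k::field ^ 2 ^ 2" where
  "mat2 a b c d = vector [vector [a, b], vector [c, d]]"

lemma mat2_entries [simp]:
  "mat2 a b c d $ 1 $ 1 = a" "mat2 a b c d $ 1 $ 2 = b"
  "mat2 a b c d $ 2 $ 1 = c" "mat2 a b c d $ 2 $ 2 = d"
  by (simp_all add: mat2_def)

lemma mat2_eq_iff:
  "g = mat2 a b c d \<longleftrightarrow> g $ 1 $ 1 = a \<and> g $ 1 $ 2 = b \<and> g $ 2 $ 1 = c \<and> g $ 2 $ 2 = d"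
  by (auto simp: vec_eq_iff forall_2)

lemma mat2_collapse: "mat2 (g $ 1 $ 1) (g $ 1 $ 2) (g $ 2 $ 1) (g $ 2 $ 2) = g"
  using mat2_eq_iff by metis

lemma mult_entries [simp]:
  fixes g h :: "'k::field ^ 2 ^ 2"
  shows "(g ** h) $ i $ j = g $ i $ 1 * h $ 1 $ j + g $ i $ 2 * h $ 2 $ j"
  by (simp add: matrix_matrix_mult_def sum_2)

lemma one_mat2: "mat 1 = mat2 1 0 0 1"
  by (simp add: mat2_eq_iff mat_def)

lemma SL2_iff: "g \<in> SL2 \<longleftrightarrow> g $ 1 $ 1 * g $ 2 $ 2 - g $ 1 $ 2 * g $ 2 $ 1 = 1"
  by (simp add: SL2_def det_2)

lemma borel_iff: "g \<in> borel \<longleftrightarrow> g $ 1 $ 2 = 0 \<and> g $ 1 $ 1 * g $ 2 $ 2 = 1"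
  by (auto simp: borel_def SL2_iff)

lemma SL2_mult: "g \<in> SL2 \<Longrightarrow> h \<in> SL2 \<Longrightarrow> g ** h \<in> SL2"
  by (simp add: SL2_def det_mul)

lemma borel_mult: "g \<in> borel \<Longrightarrow> h \<in> borel \<Longrightarrow> g ** h \<in> borel"
  unfolding borel_def using SL2_mult by auto

lemma one_in_borel: "mat 1 \<in> borel"
  by (simp add: borel_iff one_mat2)

lemma matrix_inv_SL2:
  assumes "g \<in> SL2"
  shows "matrix_inv g = mat2 (g $ 2 $ 2) (- (g $ 1 $ 2)) (- (g $ 2 $ 1)) (g $ 1 $ 1)" (is "_ = ?h")
proof -
  have gh: "g ** ?h = mat 1 \<and> ?h ** g = mat 1"
    using assms unfolding one_mat2 mat2_eq_iff by (auto simp: SL2_iff algebra_simps)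
  then have "g ** matrix_inv g = mat 1 \<and> matrix_inv g ** g = mat 1"
    unfolding matrix_inv_def by (rule someI)
  then have "matrix_inv g = matrix_inv g ** (g ** ?h)"
    using gh by (simp add: matrix_mul_rid)
  also have "\<dots> = ?h"
    using \<open>g ** matrix_inv g = mat 1 \<and> matrix_inv g ** g = mat 1\<close>
    by (simp add: matrix_mul_assoc matrix_mul_lid)
  finally show ?thesis .
qed

lemma matrix_inv_borel:
  assumes "b \<in> borel"
  shows "matrix_inv b \<in> borel" "b ** matrix_inv b = mat 1" "matrix_inv b ** b = mat 1"
proof -
  have "b \<in> SL2"
    using assms by (simp add: borel_def)
  note inv = matrix_inv_SL2[OF this]
  show "matrix_inv b \<in> borel" "b ** matrix_inv b = mat 1" "matrix_inv b ** b = mat 1"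
    using assms unfolding inv one_mat2 mat2_eq_iff by (auto simp: borel_iff mult.commute)
qed

lemma nullcone_b_eq_lie_u:
  assumes "CHAR('k::field) > 0"
  shows "(nullcone_b :: ('k ^ 2 ^ 2) set) = lie_u"
proof (intro equalityI subsetI)
  fix x :: "'k ^ 2 ^ 2" assume x: "x \<in> nullcone_b"
  then have x12: "x $ 1 $ 2 = 0"
    by (simp add: nullcone_b_def lie_b_def)
  have "mat_pow x i $ 1 $ 1 = (x $ 1 $ 1) ^ i" for i
    by (induction i) (simp_all add: mat_pow_def x12 one_mat2)
  from this[of "CHAR('k)"] have "x $ 1 $ 1 = 0"
    using x by (simp add: nullcone_b_def)
  then show "x \<in> lie_u"
    using x by (simp add: nullcone_b_def lie_b_def lie_u_def)
next
  fix x :: "'k ^ 2 ^ 2" assume x: "x \<in> lie_u"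
  have "CHAR('k) \<noteq> 1"
    by simp
  then obtain i where "CHAR('k) = Suc (Suc i)"
    using assms by (metis One_nat_def gr0_implies_Suc not_gr_zero)
  moreover have "x ** (x ** g) = 0" for g :: "'k ^ 2 ^ 2"
    using x by (simp add: lie_u_def vec_eq_iff forall_2)
  ultimately show "x \<in> nullcone_b"
    using x by (simp add: nullcone_b_def lie_b_def lie_u_def mat_pow_def)
qed


section \<open>Polynomial functions\<close>

lemma poly_funs_along_curve:
  fixes \<gamma> :: "'k::field \<Rightarrow> 'k ^ 2 ^ 2"
  assumes "F \<in> poly_funs" "\<And>i j. \<exists>P. \<forall>t. poly P t = \<gamma> t $ i $ j"
  shows "\<exists>P. \<forall>t. poly P t = F (\<gamma> t)"
  using assms(1)
proof induction
  case (const a)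
  show ?case
    by (rule exI[of _ "[:a:]"]) simp
next
  case (entry i j)
  then show ?case
    using assms(2) by simp
next
  case (add F H)
  then show ?case
    by (metis poly_add)
next
  case (mult F H)
  then show ?case
    by (metis poly_mult)
qed

lemma poly_funs_along_mat2:
  fixes a b c d :: "'k::field poly"
  assumes "F \<in> poly_funs"
  obtains P where "\<And>t. poly P t = F (mat2 (poly a t) (poly b t) (poly c t) (poly d t))"
proof -
  have "\<exists>P. \<forall>t. poly P t = mat2 (poly a t) (poly b t) (poly c t) (poly d t) $ i $ j" for i j :: 2
    using exhaust_2[of i] exhaust_2[of j] by auto
  from poly_funs_along_curve[OF assms this] that show thesis
    by blast
qed

lemma poly_funs_power: "F \<in> poly_funs \<Longrightarrow> (\<lambda>g. F g ^ i) \<in> poly_funs"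
  by (induction i) (auto intro: poly_funs.intros)

lemma poly_funs_sum:
  "(\<And>j. j \<in> A \<Longrightarrow> F j \<in> poly_funs) \<Longrightarrow> (\<lambda>g. \<Sum>j\<in>A. F j g) \<in> poly_funs"
  by (induction A rule: infinite_finite_induct) (auto intro: poly_funs.intros)

lemma poly_funs_uminus: "F \<in> poly_funs \<Longrightarrow> (\<lambda>g. - F g) \<in> poly_funs"
  using poly_funs.mult[OF poly_funs.const[of "- 1"]] by simp

lemmas poly_funs_intros = poly_funs.intros poly_funs_power poly_funs_sum poly_funs_uminus

text \<open>
  The big cell is dense: a matrix with upper right entry \<open>0\<close> is the value at \<open>t = 0\<close> of the curve
  that adds \<open>t\<close> times the first column to the second, and this curve lies in the big cell for
  \<open>t \<noteq> 0\<close>.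
\<close>

lemma poly_funs_eq_on_SL2:
  fixes F H :: "'k::alg_closed_field ^ 2 ^ 2 \<Rightarrow> 'k"
  assumes F: "F \<in> poly_funs" and H: "H \<in> poly_funs"
    and eq: "\<And>g. g \<in> SL2 \<Longrightarrow> g $ 1 $ 2 \<noteq> 0 \<Longrightarrow> F g = H g"
    and g: "g \<in> SL2"
  shows "F g = H g"
proof (cases "g $ 1 $ 2 = 0")
  case True
  then have g11: "g $ 1 $ 1 \<noteq> 0"
    using g by (auto simp: SL2_iff)
  let ?\<gamma> = "\<lambda>t. mat2 (g $ 1 $ 1) (t * g $ 1 $ 1) (g $ 2 $ 1) (g $ 2 $ 2 + t * g $ 2 $ 1)"
  let ?b = "[:0, g $ 1 $ 1:]" and ?d = "[:g $ 2 $ 2, g $ 2 $ 1:]"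
  obtain P where P: "\<And>t. poly P t = F (?\<gamma> t)"
    using poly_funs_along_mat2[OF F, of "[:g $ 1 $ 1:]" ?b "[:g $ 2 $ 1:]" ?d] by auto
  obtain Q where Q: "\<And>t. poly Q t = H (?\<gamma> t)"
    using poly_funs_along_mat2[OF H, of "[:g $ 1 $ 1:]" ?b "[:g $ 2 $ 1:]" ?d] by auto
  have "P = Q"
  proof (rule poly_eqI_nonzero_points)
    fix t :: 'k assume "t \<noteq> 0"
    moreover have "?\<gamma> t \<in> SL2"
      using g True by (simp add: SL2_iff algebra_simps)
    ultimately show "poly P t = poly Q t"
      unfolding P Q using g11 by (intro eq) simp_all
  qed
  then show ?thesis
    using P[of 0] Q[of 0] True mat2_collapse[of g] by simp
qed (use eq g in blast)


section \<open>The preimages of the Schubert varieties\<close>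

lemma flag_point_mult:
  assumes "b \<in> borel"
  shows "flag_point (g ** b) = flag_point g"
proof (intro equalityI subsetI)
  fix h assume "h \<in> flag_point (g ** b)"
  then obtain b' where "b' \<in> borel" "h = g ** (b ** b')"
    by (auto simp: flag_point_def matrix_mul_assoc)
  then show "h \<in> flag_point g"
    using assms borel_mult unfolding flag_point_def by blast
next
  fix h assume "h \<in> flag_point g"
  then obtain b' where b': "b' \<in> borel" "h = g ** b'"
    by (auto simp: flag_point_def)
  then have "h = (g ** b) ** (matrix_inv b ** b')"
    using matrix_inv_borel(2)[OF assms] by (metis matrix_mul_assoc matrix_mul_lid)
  then show "h \<in> flag_point (g ** b)"
    using b' matrix_inv_borel(1)[OF assms] borel_mult unfolding flag_point_def by blast
qed

lemma flag_point_borel: "b \<in> borel \<Longrightarrow> flag_point b = borel"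
  using flag_point_mult[of b "mat 1"] by (auto simp: flag_point_def)

lemma self_in_flag_point: "g \<in> flag_point g"
  unfolding flag_point_def using one_in_borel by (metis (mono_tags, lifting) matrix_mul_rid mem_Collect_eq)

text \<open>
  The subset of the group on which the sections over the Schubert variety live.
\<close>

definition schubert_preimage :: "weyl \<Rightarrow> ('k::field ^ 2 ^ 2) set" where
  "schubert_preimage w = \<Union>(schubert w)"

lemma schubert_preimage_e: "(schubert_preimage W_e :: ('k::field ^ 2 ^ 2) set) = borel"
proof -
  have cell: "{flag_point (b ** weyl_rep W_e) | b :: 'k ^ 2 ^ 2. b \<in> borel} = {borel}"
    using flag_point_borel one_in_borel by auto
  have "zariski_closed (borel :: ('k ^ 2 ^ 2) set)"
    unfolding zariski_closed_def
    by (rule exI[of _ "{\<lambda>g. g $ 1 $ 2}"]) (auto simp: borel_def intro: poly_funs.entry)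
  moreover have "(borel :: ('k ^ 2 ^ 2) set) \<in> flag_variety"
    unfolding flag_variety_def
    using flag_point_borel[OF one_in_borel] one_in_borel by (force simp: borel_def)
  ultimately have "flag_closed {borel :: ('k ^ 2 ^ 2) set}"
    by (simp add: flag_closed_def)
  then have "schubert W_e = {borel :: ('k ^ 2 ^ 2) set}"
    unfolding schubert_def cell by auto
  then show ?thesis
    by (simp add: schubert_preimage_def)
qed

text \<open>
  The Bruhat decomposition of the open cell, with explicit factors.
\<close>

lemma big_cell:
  fixes g :: "'k::field ^ 2 ^ 2"
  assumes "g \<in> SL2" "g $ 1 $ 2 \<noteq> 0"
  obtains b where "b \<in> borel" "g \<in> flag_point (b ** weyl_rep W_s)"
proof
  let ?y = "g $ 1 $ 2" and ?z = "g $ 2 $ 2"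
  show "mat2 1 0 (?z / ?y) 1 \<in> borel"
    by (simp add: borel_iff)
  let ?b = "mat2 (1 / ?y) 0 (g $ 1 $ 1) ?y"
  have "?b \<in> borel"
    using assms by (simp add: borel_iff)
  moreover have "g = mat2 1 0 (?z / ?y) 1 ** weyl_rep W_s ** ?b"
    using assms by (subst mat2_collapse[symmetric]) (auto simp: vec_eq_iff forall_2 SL2_iff field_simps)
  ultimately show "g \<in> flag_point (mat2 1 0 (?z / ?y) 1 ** weyl_rep W_s)"
    unfolding flag_point_def by blast
qed

lemma schubert_preimage_s: "(schubert_preimage W_s :: ('k::alg_closed_field ^ 2 ^ 2) set) = SL2"
proof (intro equalityI subsetI)
  let ?cell = "{flag_point (b ** weyl_rep W_s) | b :: 'k ^ 2 ^ 2. b \<in> borel}"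
  have rep: "(weyl_rep W_s :: 'k ^ 2 ^ 2) \<in> SL2"
    by (simp add: SL2_iff)
  {
    fix g :: "'k ^ 2 ^ 2" assume g: "g \<in> SL2"
    have "flag_point g \<in> Z" if Z: "flag_closed Z" "?cell \<subseteq> Z" for Z
    proof -
      obtain S where S: "S \<subseteq> poly_funs" "\<Union>Z = {g \<in> SL2. \<forall>F \<in> S. F g = 0}"
        using Z by (auto simp: flag_closed_def zariski_closed_def)
      have "h \<in> \<Union>Z" if "h \<in> SL2" "h $ 1 $ 2 \<noteq> 0" for h
        using big_cell[OF that] Z(2) by blast
      then have "F g = 0" if "F \<in> S" for F
        using poly_funs_eq_on_SL2[of F "\<lambda>_. 0" g] that S g poly_funs.const by blast
      then have "g \<in> \<Union>Z"
        using S g by simp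
      then obtain h where h: "flag_point h \<in> Z" "g \<in> flag_point h"
        using Z(1) by (auto simp: flag_closed_def flag_variety_def)
      from h(2) obtain b where "b \<in> borel" "g = h ** b"
        by (auto simp: flag_point_def)
      then have "flag_point g = flag_point h"
        by (simp add: flag_point_mult)
      with h show ?thesis
        by simp
    qed
    then have "flag_point g \<in> schubert W_s"
      by (auto simp: schubert_def)
    then show "g \<in> schubert_preimage W_s"
      unfolding schubert_preimage_def using self_in_flag_point by blast
  next
    fix g :: "'k ^ 2 ^ 2" assume "g \<in> schubert_preimage W_s"
    moreover have "zariski_closed (SL2 :: ('k ^ 2 ^ 2) set)"
      unfolding zariski_closed_def by (rule exI[of _ "{}"]) auto
    moreover have union: "\<Union>flag_variety = (SL2 :: ('k ^ 2 ^ 2) set)"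
      using SL2_mult self_in_flag_point by (fastforce simp: flag_variety_def flag_point_def borel_def)
    moreover have "?cell \<subseteq> flag_variety"
      using rep SL2_mult by (auto simp: flag_variety_def borel_def)
    ultimately have "flag_closed (flag_variety :: ('k ^ 2 ^ 2) set set)" "?cell \<subseteq> flag_variety"
        "g \<in> \<Union>(\<Inter>{Z. flag_closed Z \<and> ?cell \<subseteq> Z})"
      by (simp_all only: flag_closed_def schubert_preimage_def schubert_def) auto
    then have "g \<in> \<Union>flag_variety"
      by blast
    then show "g \<in> SL2"
      using union by simp
  }
qed


section \<open>Addition of sections, and derivatives of the action\<close>

lemma H0_simps:
  "carrier (H0 w n) = {f. (\<forall>g. g \<notin> schubert_preimage w \<longrightarrow> f g = 0)
     \<and> (\<exists>F \<in> poly_funs. \<forall>g \<in> schubert_preimage w. f g = F g)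
     \<and> (\<forall>g \<in> schubert_preimage w. \<forall>b \<in> borel. f (g ** b) = inverse (weight n b) * f g)}"
  "\<zero>\<^bsub>H0 w n\<^esub> = (\<lambda>g. 0)"
  "f \<oplus>\<^bsub>H0 w n\<^esub> h = (\<lambda>g. f g + h g)"
  "c \<odot>\<^bsub>H0 w n\<^esub> f = (\<lambda>g. c * f g)"
  "b_act (H0 w n) b f = (\<lambda>g. f (matrix_inv b ** g))"
  by (simp_all add: H0_def schubert_preimage_def)

lemma abelian_monoid_H0: "abelian_monoid (H0 w n :: ('k::field, 'k ^ 2 ^ 2 \<Rightarrow> 'k) B_module)"
proof (rule abelian_monoidI)
  fix f h :: "'k ^ 2 ^ 2 \<Rightarrow> 'k" assume f: "f \<in> carrier (H0 w n)" and h: "h \<in> carrier (H0 w n)"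
  from f obtain F where F: "F \<in> poly_funs" "\<forall>g \<in> schubert_preimage w. f g = F g"
    by (auto simp: H0_simps)
  from h obtain H where H: "H \<in> poly_funs" "\<forall>g \<in> schubert_preimage w. h g = H g"
    by (auto simp: H0_simps)
  have "\<exists>K\<in>poly_funs. \<forall>g \<in> schubert_preimage w. f g + h g = K g"
    using F H by (intro bexI[of _ "\<lambda>g. F g + H g"]) (auto intro: poly_funs.intros)
  then show "f \<oplus>\<^bsub>H0 w n\<^esub> h \<in> carrier (H0 w n)"
    using f h by (simp add: H0_simps distrib_left)
next
  show "\<zero>\<^bsub>H0 w n\<^esub> \<in> carrier (H0 w n)"
    by (auto simp: H0_simps intro: poly_funs.intros)
qed (simp_all add: H0_simps add_ac)

lemma smult_H0_closed:
  assumes "f \<in> carrier (H0 w n)"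
  shows "c \<odot>\<^bsub>H0 w n\<^esub> f \<in> carrier (H0 w n)"
proof -
  obtain F where "F \<in> poly_funs" "\<forall>g \<in> schubert_preimage w. f g = F g"
    using assms by (auto simp: H0_simps)
  then have "\<exists>K\<in>poly_funs. \<forall>g \<in> schubert_preimage w. c * f g = K g"
    by (intro bexI[of _ "\<lambda>g. c * F g"]) (auto intro: poly_funs.intros)
  then show ?thesis
    using assms by (simp add: H0_simps)
qed

lemma finsum_H0:
  assumes "finite A" "\<And>s. s \<in> A \<Longrightarrow> f s \<in> carrier (H0 w n)"
  shows "finsum (H0 w n) f A g = (\<Sum>s\<in>A. f s g)"
  using assms
proof (induction A rule: finite_induct)
  case empty
  then show ?case
    by (simp add: abelian_monoid.finsum_empty[OF abelian_monoid_H0] H0_simps)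
next
  case (insert s A)
  then have "finsum (H0 w n) f (insert s A) = f s \<oplus>\<^bsub>H0 w n\<^esub> finsum (H0 w n) f A"
    by (intro abelian_monoid.finsum_insert[OF abelian_monoid_H0]) auto
  with insert show ?case
    by (simp add: H0_simps)
qed

text \<open>
  The definition of the Lie algebra action chooses some expansion of the orbit map with regular
  coefficients. Evaluating an expansion at a point \<open>g\<close> along the line \<open>1 + t x\<close>, which lies in \<open>B\<close>
  for \<open>x \<in> \<uu>\<close>, gives a polynomial in \<open>t\<close> that depends on the section alone; its linear coefficient
  is the value at \<open>g\<close> of the derived section. So the choice does not matter, and the
  action can be read off pointwise.
\<close>

lemma lie_act_H0_eqI:
  fixes u v :: "'k::alg_closed_field ^ 2 ^ 2 \<Rightarrow> 'k"
  assumes x: "x \<in> lie_u"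
    and rational: "finite S" "S \<subseteq> carrier (H0 w n)" "h ` S \<subseteq> poly_funs"
      "\<And>b. b \<in> borel \<Longrightarrow> b_act (H0 w n) b v = finsum (H0 w n) (\<lambda>s. h s b \<odot>\<^bsub>H0 w n\<^esub> s) S"
    and expansion: "\<And>g. \<exists>R. (\<forall>t. poly R t = v (mat2 1 0 (- t * x $ 2 $ 1) 1 ** g)) \<and> coeff R 1 = u g"
  shows "lie_act (H0 w n) x v = u"
proof -
  let ?M = "H0 w n :: ('k, 'k ^ 2 ^ 2 \<Rightarrow> 'k) B_module"
  let ?rep = "\<lambda>S h. finite S \<and> S \<subseteq> carrier ?M \<and> h ` S \<subseteq> poly_funs
      \<and> (\<forall>b \<in> borel. b_act ?M b v = finsum ?M (\<lambda>s. h s b \<odot>\<^bsub>?M\<^esub> s) S)"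
  let ?diff = "\<lambda>S h. finsum ?M (\<lambda>s. deriv_at_one (h s) x \<odot>\<^bsub>?M\<^esub> s) S"
  have line: "mat 1 + (\<chi> i j. t * x $ i $ j) = mat2 1 0 (t * x $ 2 $ 1) 1" for t
    using x by (simp add: mat2_eq_iff one_mat2 lie_u_def)
  have line_borel: "mat2 1 0 (t * x $ 2 $ 1) 1 \<in> borel" for t
    by (simp add: borel_iff)
  have line_inv: "matrix_inv (mat2 1 0 (t * x $ 2 $ 1) 1) = mat2 1 0 (- t * x $ 2 $ 1) 1" for t
    using line_borel[of t] by (subst matrix_inv_SL2) (simp_all add: borel_def)
  have unique: "?diff S h = u" if rep: "?rep S h" for S h
  proof
    fix g
    have "\<exists>P. \<forall>s\<in>S. \<forall>t. poly (P s) t = h s (mat2 1 0 (t * x $ 2 $ 1) 1)"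
    proof (intro bchoice ballI)
      fix s assume "s \<in> S"
      then have "h s \<in> poly_funs"
        using rep by auto
      then show "\<exists>P. \<forall>t. poly P t = h s (mat2 1 0 (t * x $ 2 $ 1) 1)"
        using poly_funs_along_mat2[of "h s" "[:1:]" "[:0:]" "[:0, x $ 2 $ 1:]" "[:1:]"]
        by (auto simp: mult.commute)
    qed
    then obtain P where P: "\<And>s t. s \<in> S \<Longrightarrow> poly (P s) t = h s (mat2 1 0 (t * x $ 2 $ 1) 1)"
      by blast
    have deriv: "deriv_at_one (h s) x = coeff (P s) 1" if "s \<in> S" for s
    proof -
      have "(THE P. \<forall>t. poly P t = h s (mat 1 + (\<chi> i j. t * x $ i $ j))) = P s"
        unfolding line
        by (rule the_equality) (use P[OF that] in \<open>auto intro: poly_eqI_nonzero_points\<close>)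
      then show ?thesis
        by (simp add: deriv_at_one_def)
    qed
    obtain R where R: "\<And>t. poly R t = v (mat2 1 0 (- t * x $ 2 $ 1) 1 ** g)" "coeff R 1 = u g"
      using expansion[of g] by blast
    have "(\<Sum>s\<in>S. smult (s g) (P s)) = R"
    proof (rule poly_eqI_nonzero_points)
      fix t :: 'k
      have "poly R t = b_act ?M (mat2 1 0 (t * x $ 2 $ 1) 1) v g"
        by (simp add: R H0_simps line_inv)
      also have "\<dots> = finsum ?M (\<lambda>s. h s (mat2 1 0 (t * x $ 2 $ 1) 1) \<odot>\<^bsub>?M\<^esub> s) S g"
        using rep line_borel[of t] by simp
      also have "\<dots> = (\<Sum>s\<in>S. (h s (mat2 1 0 (t * x $ 2 $ 1) 1) \<odot>\<^bsub>?M\<^esub> s) g)"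
        using rep by (intro finsum_H0 smult_H0_closed) auto
      also have "\<dots> = (\<Sum>s\<in>S. h s (mat2 1 0 (t * x $ 2 $ 1) 1) * s g)"
        by (simp only: H0_simps)
      finally show "poly (\<Sum>s\<in>S. smult (s g) (P s)) t = poly R t"
        by (simp add: poly_sum P mult.commute)
    qed
    moreover have "?diff S h g = (\<Sum>s\<in>S. (deriv_at_one (h s) x \<odot>\<^bsub>?M\<^esub> s) g)"
      using rep by (intro finsum_H0 smult_H0_closed) auto
    then have "?diff S h g = (\<Sum>s\<in>S. coeff (P s) 1 * s g)"
      by (simp add: H0_simps(4) deriv)
    ultimately show "?diff S h g = u g"
      using R(2) by (auto simp: coeff_sum mult.commute)
  qed
  have rep: "?rep S h"
    using rational by simp
  show ?thesis
    unfolding lie_act_def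
  proof (rule some_equality)
    show "\<exists>S h. finite S \<and> S \<subseteq> carrier ?M \<and> h ` S \<subseteq> poly_funs
        \<and> (\<forall>b \<in> borel. b_act ?M b v = finsum ?M (\<lambda>s. h s b \<odot>\<^bsub>?M\<^esub> s) S) \<and> u = ?diff S h"
      by (rule exI[of _ S], rule exI[of _ h])
        (intro conjI ballI rational unique[OF rep, symmetric])
  next
    fix u'
    assume "\<exists>S h. finite S \<and> S \<subseteq> carrier ?M \<and> h ` S \<subseteq> poly_funs
        \<and> (\<forall>b \<in> borel. b_act ?M b v = finsum ?M (\<lambda>s. h s b \<odot>\<^bsub>?M\<^esub> s) S) \<and> u' = ?diff S h"
    then show "u' = u"
      by (elim exE conjE) (rule trans, assumption, rule unique, intro conjI, assumption+)
  qed
qed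


section \<open>Sections as binary forms\<close>

fun form_degree :: "weyl \<Rightarrow> nat \<Rightarrow> nat" where
  "form_degree W_e n = 0"
| "form_degree W_s n = n"

definition form :: "nat \<Rightarrow> 'k::field poly \<Rightarrow> 'k \<Rightarrow> 'k \<Rightarrow> 'k" where
  "form N P y z = (\<Sum>j\<le>N. coeff P j * y ^ (N - j) * z ^ j)"

text \<open>
  A homogeneous function of degree \<open>n\<close> of the second column. Over \<open>X(e)\<close> the form has degree
  \<open>0\<close> and the factor \<open>z\<^sup>n\<close> carries the weight; over \<open>X(s)\<close> this factor is trivial.
\<close>

definition form_section :: "weyl \<Rightarrow> nat \<Rightarrow> 'k::field poly \<Rightarrow> 'k ^ 2 ^ 2 \<Rightarrow> 'k" where
  "form_section w n P g = (if g \<in> schubert_preimage w then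
     form (form_degree w n) P (g $ 1 $ 2) (g $ 2 $ 2) * (g $ 2 $ 2) ^ (n - form_degree w n) else 0)"

lemma form_degree_le: "form_degree w n \<le> n"
  by (cases w) auto

lemma form_homogeneous: "form N P (d * y) (d * z) = d ^ N * form N P y z"
proof -
  have "d ^ (N - j) * d ^ j = d ^ N" if "j \<le> N" for j
    using that by (simp flip: power_add)
  then show ?thesis
    unfolding form_def sum_distrib_left
    by (intro sum.cong) (auto simp: power_mult_distrib mult_ac)
qed

lemma form_dehomogenize:
  assumes "y \<noteq> 0" "degree P \<le> N"
  shows "form N P y z = y ^ N * poly P (z / y)"
proof -
  have "poly P (z / y) = (\<Sum>j\<le>N. coeff P j * (z / y) ^ j)"
    unfolding poly_altdef using assms
    by (intro sum.mono_neutral_left) (auto simp: coeff_eq_0)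
  moreover have "y ^ N * (z / y) ^ j = y ^ (N - j) * z ^ j" if "j \<le> N" for j
    using assms that by (simp add: power_divide power_diff)
  ultimately show ?thesis
    unfolding form_def by (simp add: sum_distrib_left mult.left_commute mult.assoc)
qed

lemma form_poly_funs: "(\<lambda>g. form N P (g $ 1 $ 2) (g $ 2 $ 2)) \<in> poly_funs"
  unfolding form_def by (intro poly_funs_intros)

lemma schubert_preimage_mult_right:
  fixes g :: "'k::alg_closed_field ^ 2 ^ 2"
  shows "g \<in> schubert_preimage w \<Longrightarrow> b \<in> borel \<Longrightarrow> g ** b \<in> schubert_preimage w"
  using SL2_mult borel_mult by (cases w) (auto simp: schubert_preimage_e schubert_preimage_s borel_def)

lemma schubert_preimage_mult_left_iff:
  assumes "b \<in> borel"
  shows "b ** g \<in> schubert_preimage w \<longleftrightarrow> g \<in> (schubert_preimage w :: ('k::alg_closed_field ^ 2 ^ 2) set)"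
proof -
  have closed: "c ** h \<in> schubert_preimage w" if "c \<in> borel" "h \<in> schubert_preimage w" for c h :: "'k ^ 2 ^ 2"
    using that SL2_mult borel_mult by (cases w) (auto simp: schubert_preimage_e schubert_preimage_s borel_def)
  have "g = matrix_inv b ** (b ** g)"
    using matrix_inv_borel(3)[OF assms] by (simp add: matrix_mul_assoc matrix_mul_lid)
  then show ?thesis
    using closed assms matrix_inv_borel(1)[OF assms] by metis
qed

lemma inverse_weight:
  assumes "b \<in> borel"
  shows "inverse (weight n b) = (b $ 2 $ 2) ^ n"
proof (rule inverse_unique)
  show "weight n b * (b $ 2 $ 2) ^ n = 1"
    using assms by (simp add: borel_iff weight_def flip: power_mult_distrib)
qed

lemma form_section_in_H0:
  fixes P :: "'k::alg_closed_field poly"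
  shows "form_section w n P \<in> carrier (H0 w n)"
proof -
  let ?N = "form_degree w n"
  let ?F = "\<lambda>g. form ?N P (g $ 1 $ 2) (g $ 2 $ 2) * (g $ 2 $ 2) ^ (n - ?N)"
  have "?F \<in> poly_funs"
    by (intro poly_funs_intros form_poly_funs)
  then have "\<exists>F\<in>poly_funs. \<forall>g \<in> schubert_preimage w. form_section w n P g = F g"
    by (intro bexI[of _ ?F]) (simp_all add: form_section_def)
  moreover have "form_section w n P (g ** b) = inverse (weight n b) * form_section w n P g"
    if g: "g \<in> schubert_preimage w" and b: "b \<in> borel" for g b :: "'k ^ 2 ^ 2"
  proof -
    let ?d = "b $ 2 $ 2"
    have col: "(g ** b) $ 1 $ 2 = ?d * g $ 1 $ 2" "(g ** b) $ 2 $ 2 = ?d * g $ 2 $ 2"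
      using b by (simp_all add: borel_iff)
    have "form_section w n P (g ** b) = ?d ^ ?N * ?d ^ (n - ?N) * form_section w n P g"
      unfolding form_section_def col form_homogeneous
      using g schubert_preimage_mult_right[OF g b] by (simp add: power_mult_distrib mult_ac)
    then show ?thesis
      using form_degree_le[of w n] by (simp add: inverse_weight[OF b] flip: power_add)
  qed
  ultimately show ?thesis
    by (simp add: H0_simps form_section_def)
qed

lemma form_section_inject:
  fixes P Q :: "'k::alg_closed_field poly"
  assumes deg: "degree P \<le> form_degree w n" "degree Q \<le> form_degree w n"
    and eq: "form_section w n P = form_section w n Q"
  shows "P = Q"
proof (cases w)
  case W_e
  have "(mat 1 :: 'k ^ 2 ^ 2) \<in> borel"
    by (rule one_in_borel)
  with W_e have "coeff P 0 = coeff Q 0"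
    using fun_cong[OF eq, of "mat 1"]
    by (simp add: form_section_def form_def schubert_preimage_e one_mat2)
  then show ?thesis
    using deg W_e by (metis degree_0_id form_degree.simps(1) le_zero_eq)
next
  case W_s
  show ?thesis
  proof (rule poly_eqI_nonzero_points)
    fix t :: 'k
    have "mat2 0 1 (- 1) t \<in> SL2"
      by (simp add: SL2_iff)
    then show "poly P t = poly Q t"
      using fun_cong[OF eq, of "mat2 0 1 (- 1) t"] deg W_s
      by (simp add: form_section_def schubert_preimage_s form_dehomogenize)
  qed
qed

lemma H0_e_is_form_section:
  fixes f :: "'k::alg_closed_field ^ 2 ^ 2 \<Rightarrow> 'k"
  assumes "f \<in> carrier (H0 W_e n)"
  shows "f = form_section W_e n [:f (mat 1):]"
proof
  fix g
  show "f g = form_section W_e n [:f (mat 1):] g"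
  proof (cases "g \<in> borel")
    case True
    have "(mat 1 :: 'k ^ 2 ^ 2) \<in> borel"
      by (rule one_in_borel)
    with True have "f (mat 1 ** g) = inverse (weight n g) * f (mat 1)"
      using assms by (simp add: H0_simps schubert_preimage_e del: matrix_mul_lid)
    then show ?thesis
      using True by (simp add: inverse_weight matrix_mul_lid form_section_def form_def schubert_preimage_e)
  next
    case False
    then show ?thesis
      using assms by (simp add: H0_simps schubert_preimage_e form_section_def)
  qed
qed

text \<open>
  A section is determined by its restriction \<open>P\<close> to the line of matrices with second column
  \<open>(1, t)\<close>, because this line meets every coset of \<open>B\<close> in the big cell. The bound on the degree
  expresses regularity outside of the big cell: along the second column \<open>(y, 1)\<close> the section
  equals \<open>y\<^sup>n P(1/y)\<close>, which has no pole at \<open>y = 0\<close>.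
\<close>

lemma H0_s_is_form_section:
  fixes f :: "'k::alg_closed_field ^ 2 ^ 2 \<Rightarrow> 'k"
  assumes f: "f \<in> carrier (H0 W_s n)"
  obtains P where "degree P \<le> n" "f = form_section W_s n P"
proof -
  obtain F where F: "F \<in> poly_funs" "\<And>g. g \<in> SL2 \<Longrightarrow> f g = F g"
    using f by (auto simp: H0_simps schubert_preimage_s)
  obtain P where P: "\<And>t. poly P t = F (mat2 0 1 (- 1) t)"
    using poly_funs_along_mat2[OF F(1), of "[:0:]" "[:1:]" "[:- 1:]" "[:0, 1:]"] by auto
  have value_big_cell: "f g = (g $ 1 $ 2) ^ n * poly P (g $ 2 $ 2 / g $ 1 $ 2)"
    if g: "g \<in> SL2" "g $ 1 $ 2 \<noteq> 0" for g
  proof -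
    let ?y = "g $ 1 $ 2" and ?z = "g $ 2 $ 2"
    let ?b = "mat2 (1 / ?y) 0 (g $ 1 $ 1) ?y" and ?w = "mat2 0 1 (- 1) (?z / ?y)"
    have "g = ?w ** ?b"
      using g by (simp add: vec_eq_iff forall_2 SL2_iff field_simps)
    then have "f g = f (?w ** ?b)"
      by (rule arg_cong)
    also have w: "?w \<in> SL2" and "?b \<in> borel"
      using g by (simp_all add: SL2_iff borel_iff)
    then have "f (?w ** ?b) = inverse (weight n ?b) * f ?w"
      using f by (simp add: H0_simps schubert_preimage_s)
    also have "\<dots> = ?y ^ n * poly P (?z / ?y)"
      using w by (simp add: weight_def F P power_one_over)
    finally show ?thesis .
  qed
  have deg: "degree P \<le> n"
  proof (rule ccontr)
    assume d: "\<not> degree P \<le> n"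
    obtain Q where Q: "\<And>y. poly Q y = F (mat2 1 y 0 1)"
      using poly_funs_along_mat2[OF F(1), of "[:1:]" "[:0, 1:]" "[:0:]" "[:1:]"] by auto
    \<comment> \<open>At \<open>y = 0\<close> the left-hand side is the leading coefficient of \<open>P\<close>, the right-hand side \<open>0\<close>.\<close>
    have "reflect_poly P = monom 1 (degree P - n) * Q"
    proof (rule poly_eqI_nonzero_points)
      fix y :: 'k assume y: "y \<noteq> 0"
      have "mat2 1 y 0 1 \<in> SL2"
        by (simp add: SL2_iff)
      then have "poly Q y = y ^ n * poly P (inverse y)"
        using value_big_cell[of "mat2 1 y 0 1"] y by (simp add: Q F divide_inverse)
      moreover have "y ^ degree P = y ^ (degree P - n) * y ^ n"
        using d by (simp flip: power_add)
      ultimately show "poly (reflect_poly P) y = poly (monom 1 (degree P - n) * Q) y"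
        using y by (simp add: poly_reflect_poly_nz poly_monom)
    qed
    then have "coeff (reflect_poly P) 0 = coeff (monom 1 (degree P - n) * Q) 0"
      by simp
    then have "lead_coeff P = 0"
      using d by (simp add: coeff_monom_mult)
    then show False
      using d by simp
  qed
  have "f g = form_section W_s n P g" for g
  proof (cases "g \<in> SL2")
    case True
    have "F g = form n P (g $ 1 $ 2) (g $ 2 $ 2)"
      using F(1) form_poly_funs _ True
    proof (rule poly_funs_eq_on_SL2)
      fix h :: "'k ^ 2 ^ 2" assume "h \<in> SL2" "h $ 1 $ 2 \<noteq> 0"
      then show "F h = form n P (h $ 1 $ 2) (h $ 2 $ 2)"
        using value_big_cell[of h] deg by (simp add: F form_dehomogenize)
    qed
    with True show ?thesis
      by (simp add: F form_section_def schubert_preimage_s)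
  next
    case False
    then show ?thesis
      using f by (simp add: H0_simps schubert_preimage_s form_section_def)
  qed
  then show thesis
    using that deg by blast
qed

lemma form_section_bij:
  "bij_betw (form_section w n) {P :: 'k::alg_closed_field poly. degree P \<le> form_degree w n} (carrier (H0 w n))"
proof (rule bij_betw_imageI)
  show "inj_on (form_section w n) {P :: 'k poly. degree P \<le> form_degree w n}"
    by (rule inj_onI) (use form_section_inject in auto)
  have "f \<in> form_section w n ` {P. degree P \<le> form_degree w n}"
    if f: "f \<in> carrier (H0 w n)" for f :: "'k ^ 2 ^ 2 \<Rightarrow> 'k"
  proof (cases w)
    case W_e
    then show ?thesis
      using H0_e_is_form_section[of f n] f by (intro image_eqI[of _ _ "[:f (mat 1):]"]) auto
  next
    case W_s
    then show ?thesis
      using H0_s_is_form_section[of f n] f by (auto intro: image_eqI)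
  qed
  then show "form_section w n ` {P. degree P \<le> form_degree w n} = carrier (H0 w n :: ('k, _) B_module)"
    using form_section_in_H0 by blast
qed


section \<open>The action of the Borel subgroup and its Lie algebra on forms\<close>

lemma form_add: "form N (P + Q) y z = form N P y z + form N Q y z"
  by (simp add: form_def sum.distrib distrib_right)

lemma form_smult: "form N (smult a P) y z = a * form N P y z"
  by (simp add: form_def sum_distrib_left mult.assoc)

lemma form_monom: "k \<le> N \<Longrightarrow> form N (monom 1 k) y z = y ^ (N - k) * z ^ k"
  by (simp add: form_def coeff_monom if_distrib[of "\<lambda>a. a * _"] cong: if_cong)

lemma form_section_add:
  "form_section w n (P + Q) = form_section w n P \<oplus>\<^bsub>H0 w n\<^esub> form_section w n Q"
  by (simp add: H0_simps form_section_def form_add distrib_right fun_eq_iff)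

lemma form_section_zero: "form_section w n 0 = \<zero>\<^bsub>H0 w n\<^esub>"
  by (simp add: H0_simps form_section_def form_def fun_eq_iff)

lemma form_section_smult: "form_section w n (smult a P) = a \<odot>\<^bsub>H0 w n\<^esub> form_section w n P"
  by (simp add: H0_simps form_section_def form_smult mult.assoc fun_eq_iff)

text \<open>
  Translation by \<open>b \<in> B\<close> with diagonal entries \<open>a\<close>, \<open>d\<close> and lower left entry \<open>c\<close> substitutes
  \<open>(d y, a z - c y)\<close> for \<open>(y, z)\<close>. Expanding with the binomial theorem shows the matrix
  coefficients to be polynomials in the entries of \<open>b\<close>.
\<close>

lemma form_borel_substitution:
  "form N P (d * y) (a * z - c * y) =
    (\<Sum>k\<le>N. (\<Sum>j\<le>N. coeff P j * of_nat (j choose k) * d ^ (N - j) * a ^ k * (- c) ^ (j - k))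
      * (y ^ (N - k) * z ^ k))"
proof -
  have "coeff P j * (d * y) ^ (N - j) * (a * z - c * y) ^ j =
      (\<Sum>k\<le>N. coeff P j * of_nat (j choose k) * d ^ (N - j) * a ^ k * (- c) ^ (j - k)
        * (y ^ (N - k) * z ^ k))" if j: "j \<le> N" for j
  proof -
    have "(a * z - c * y) ^ j = (\<Sum>k\<le>j. of_nat (j choose k) * (a * z) ^ k * ((- c) * y) ^ (j - k))"
      using binomial_ring[of "a * z" "(- c) * y" j] by simp
    also have "\<dots> = (\<Sum>k\<le>N. of_nat (j choose k) * (a * z) ^ k * ((- c) * y) ^ (j - k))"
      using j by (intro sum.mono_neutral_left) (auto simp: binomial_eq_0)
    finally have expand: "(a * z - c * y) ^ j =
        (\<Sum>k\<le>N. of_nat (j choose k) * (a * z) ^ k * ((- c) * y) ^ (j - k))" .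
    show ?thesis
      unfolding expand sum_distrib_left
    proof (rule sum.cong)
      fix k assume "k \<in> {..N}"
      show "coeff P j * (d * y) ^ (N - j) *
          (of_nat (j choose k) * (a * z) ^ k * ((- c) * y) ^ (j - k)) =
        coeff P j * of_nat (j choose k) * d ^ (N - j) * a ^ k * (- c) ^ (j - k) *
          (y ^ (N - k) * z ^ k)"
      proof (cases "k \<le> j")
        case True
        then have "y ^ (N - k) = y ^ (N - j) * y ^ (j - k)"
          using j by (simp flip: power_add)
        then show ?thesis
          by (simp only: power_mult_distrib mult_ac)
      qed (simp add: binomial_eq_0)
    qed simp
  qed
  then have "form N P (d * y) (a * z - c * y) =
      (\<Sum>j\<le>N. \<Sum>k\<le>N. coeff P j * of_nat (j choose k) * d ^ (N - j) * a ^ k * (- c) ^ (j - k)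
        * (y ^ (N - k) * z ^ k))"
    by (simp add: form_def)
  then show ?thesis
    by (subst (asm) sum.swap) (simp only: sum_distrib_right)
qed

definition translation_coeff :: "weyl \<Rightarrow> nat \<Rightarrow> 'k::field poly \<Rightarrow> nat \<Rightarrow> 'k ^ 2 ^ 2 \<Rightarrow> 'k" where
  "translation_coeff w n P k b = (let N = form_degree w n in
     (\<Sum>j\<le>N. coeff P j * of_nat (j choose k) * (b $ 2 $ 2) ^ (N - j) * (b $ 1 $ 1) ^ k
        * (- (b $ 2 $ 1)) ^ (j - k)) * (b $ 1 $ 1) ^ (n - N))"

lemma translation_coeff_poly_funs: "translation_coeff w n P k \<in> poly_funs"
  unfolding translation_coeff_def Let_def by (intro poly_funs_intros)

lemma form_section_translate:
  fixes P :: "'k::alg_closed_field poly"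
  assumes b: "b \<in> borel"
  shows "form_section w n P (matrix_inv b ** g) =
    (\<Sum>k\<le>form_degree w n. translation_coeff w n P k b * form_section w n (monom 1 k) g)"
proof (cases "g \<in> schubert_preimage w")
  case False
  then have "matrix_inv b ** g \<notin> schubert_preimage w"
    using schubert_preimage_mult_left_iff matrix_inv_borel(1)[OF b] by blast
  with False show ?thesis
    by (simp add: form_section_def)
next
  case True
  let ?N = "form_degree w n"
  let ?a = "b $ 1 $ 1" and ?c = "b $ 2 $ 1" and ?d = "b $ 2 $ 2"
  let ?y = "g $ 1 $ 2" and ?z = "g $ 2 $ 2"
  have in_pre: "matrix_inv b ** g \<in> schubert_preimage w"
    using True schubert_preimage_mult_left_iff matrix_inv_borel(1)[OF b] by blast
  have inv: "matrix_inv b = mat2 ?d 0 (- ?c) ?a"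
    using b by (simp add: borel_def matrix_inv_SL2)
  have col: "(matrix_inv b ** g) $ 1 $ 2 = ?d * ?y" "(matrix_inv b ** g) $ 2 $ 2 = ?a * ?z - ?c * ?y"
    by (simp_all add: inv)
  \<comment> \<open>Either the exponent is \<open>0\<close>, or \<open>g\<close> lies in \<open>B\<close> and \<open>y = 0\<close>.\<close>
  have tail: "(?a * ?z - ?c * ?y) ^ (n - ?N) = ?a ^ (n - ?N) * ?z ^ (n - ?N)"
    using True by (cases w) (auto simp: schubert_preimage_e borel_iff power_mult_distrib)
  have "form_section w n P (matrix_inv b ** g) =
      form ?N P (?d * ?y) (?a * ?z - ?c * ?y) * (?a ^ (n - ?N) * ?z ^ (n - ?N))"
    using in_pre unfolding form_section_def col by (simp add: tail)
  also have "\<dots> = (\<Sum>k\<le>?N. translation_coeff w n P k b * (?y ^ (?N - k) * ?z ^ k * ?z ^ (n - ?N)))"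
    unfolding form_borel_substitution sum_distrib_right translation_coeff_def Let_def
    by (intro sum.cong) (simp_all add: sum_distrib_left sum_distrib_right mult_ac)
  also have "\<dots> = (\<Sum>k\<le>?N. translation_coeff w n P k b * form_section w n (monom 1 k) g)"
    using True by (intro sum.cong) (simp_all add: form_section_def form_monom)
  finally show ?thesis .
qed

lemma coeff_linear_power_1:
  "coeff ([:a, b:] ^ j) (Suc 0) = (of_nat j * a ^ (j - 1) * b :: 'k::comm_ring_1)"
proof (induction j)
  case (Suc j)
  have "a * (of_nat j * a ^ (j - 1) * b) = of_nat j * a ^ j * b"
    by (cases j) (simp_all add: mult_ac)
  then show ?case
    using Suc by (simp add: coeff_0_power algebra_simps)
qed simp

text \<open>
  Moving \<open>z\<close> in the direction \<open>c y\<close> applies the derivation \<open>c y \<partial>/\<partial>z\<close> to a form, and this is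
  \<open>c\<close> times the derivative of the polynomial obtained by setting \<open>y = 1\<close>.
\<close>

lemma form_deriv:
  fixes P :: "'k::field poly"
  assumes "degree P \<le> N"
  shows "\<exists>R. (\<forall>t. poly R t = form N P y (z + t * (c * y))) \<and> coeff R 1 = form N (scaled_deriv c P) y z"
proof (intro exI conjI allI)
  define R where "R = (\<Sum>j\<le>N. smult (coeff P j * y ^ (N - j)) ([:z, c * y:] ^ j))"
  show "poly R t = form N P y (z + t * (c * y))" for t
    by (simp add: R_def form_def poly_sum)
  have R1: "coeff R 1 = (\<Sum>j\<le>N. coeff P j * y ^ (N - j) * (of_nat j * z ^ (j - 1) * (c * y)))"
    by (simp add: R_def coeff_sum coeff_linear_power_1)
  show "coeff R 1 = form N (scaled_deriv c P) y z"
  proof (cases N)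
    case 0
    then show ?thesis
      using assms unfolding R1 by (simp add: form_def scaled_deriv_def coeff_pderiv coeff_eq_0)
  next
    case (Suc N')
    have "coeff R 1 = (\<Sum>j\<le>N'. coeff P (Suc j) * y ^ (N' - j) * (of_nat (Suc j) * z ^ j * (c * y)))"
      unfolding R1 Suc by (subst sum.atMost_Suc_shift) simp
    also have "\<dots> = (\<Sum>j\<le>N'. coeff (scaled_deriv c P) j * y ^ (Suc N' - j) * z ^ j)"
      by (intro sum.cong) (simp_all add: scaled_deriv_def coeff_pderiv Suc_diff_le mult_ac)
    also have "\<dots> = form N (scaled_deriv c P) y z"
      using assms by (simp add: form_def Suc scaled_deriv_def coeff_pderiv coeff_eq_0)
    finally show ?thesis .
  qed
qed

text \<open>
  The sign arises because \<open>b\<close> acts on functions through \<open>b\<^sup>-\<^sup>1\<close>.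
\<close>

lemma lie_act_form_section:
  fixes P :: "'k::alg_closed_field poly"
  assumes x: "x \<in> lie_u" and deg: "degree P \<le> form_degree w n"
  shows "lie_act (H0 w n) x (form_section w n P) = form_section w n (scaled_deriv (- (x $ 2 $ 1)) P)"
proof -
  let ?N = "form_degree w n" and ?s = "\<lambda>k. form_section w n (monom 1 k :: 'k poly)"
  \<comment> \<open>The coefficients of an expansion are indexed by the sections themselves, so the exponent of a
    monomial has to be recovered from its section.\<close>
  define idx where "idx = inv_into {..?N} ?s"
  have inj: "inj_on ?s {..?N}"
  proof (rule inj_onI)
    fix k l assume "k \<in> {..?N}" "l \<in> {..?N}" "?s k = ?s l"
    then have "monom 1 k = (monom 1 l :: 'k poly)"
      by (intro form_section_inject[of _ w n]) (simp_all add: degree_monom_eq)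
    then show "k = l"
      by (simp add: monom_eq_iff')
  qed
  then have idx: "idx (?s k) = k" if "k \<le> ?N" for k
    using inv_into_f_f[OF inj, of k] that by (simp add: idx_def)
  show ?thesis
  proof (rule lie_act_H0_eqI[OF x])
    show "finite (?s ` {..?N})" "?s ` {..?N} \<subseteq> carrier (H0 w n)"
      using form_section_in_H0 by auto
    show "(\<lambda>s. translation_coeff w n P (idx s)) ` ?s ` {..?N} \<subseteq> poly_funs"
      using translation_coeff_poly_funs by auto
  next
    fix b :: "'k ^ 2 ^ 2" assume b: "b \<in> borel"
    show "b_act (H0 w n) b (form_section w n P) =
        finsum (H0 w n) (\<lambda>s. translation_coeff w n P (idx s) b \<odot>\<^bsub>H0 w n\<^esub> s) (?s ` {..?N})"
    proof
      fix g
      have "finsum (H0 w n) (\<lambda>s. translation_coeff w n P (idx s) b \<odot>\<^bsub>H0 w n\<^esub> s) (?s ` {..?N}) g =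
          (\<Sum>s\<in>?s ` {..?N}. (translation_coeff w n P (idx s) b \<odot>\<^bsub>H0 w n\<^esub> s) g)"
        by (intro finsum_H0 smult_H0_closed) (auto simp: form_section_in_H0)
      also have "\<dots> = (\<Sum>k\<le>?N. translation_coeff w n P k b * ?s k g)"
        by (subst sum.reindex[OF inj]) (simp add: H0_simps idx)
      also have "\<dots> = b_act (H0 w n) b (form_section w n P) g"
        by (simp add: H0_simps form_section_translate[OF b])
      finally show "b_act (H0 w n) b (form_section w n P) g =
        finsum (H0 w n) (\<lambda>s. translation_coeff w n P (idx s) b \<odot>\<^bsub>H0 w n\<^esub> s) (?s ` {..?N}) g" ..
    qed
  next
    fix g :: "'k ^ 2 ^ 2"
    let ?c = "- (x $ 2 $ 1)" and ?y = "g $ 1 $ 2" and ?z = "g $ 2 $ 2"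
    let ?b = "\<lambda>t. mat2 1 0 (- t * x $ 2 $ 1) 1"
    have pre: "?b t ** g \<in> schubert_preimage w \<longleftrightarrow> g \<in> schubert_preimage w" for t
      by (rule schubert_preimage_mult_left_iff) (simp add: borel_iff)
    show "\<exists>R. (\<forall>t. poly R t = form_section w n P (?b t ** g)) \<and>
        coeff R 1 = form_section w n (scaled_deriv ?c P) g"
    proof (cases "g \<in> schubert_preimage w")
      case False
      then show ?thesis
        unfolding form_section_def pre by (intro exI[of _ 0]) simp
    next
      case True
      obtain R where R: "\<And>t. poly R t = form ?N P ?y (?z + t * (?c * ?y))"
          "coeff R 1 = form ?N (scaled_deriv ?c P) ?y ?z"
        using form_deriv[OF deg, of ?y ?z ?c] by blast
      have col: "(?b t ** g) $ 1 $ 2 = ?y" "(?b t ** g) $ 2 $ 2 = ?z + t * (?c * ?y)" for t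
        by (simp_all add: algebra_simps)
      have tail: "(?z + t * (?c * ?y)) ^ (n - ?N) = ?z ^ (n - ?N)" for t
        using True by (cases w) (auto simp: schubert_preimage_e borel_iff)
      show ?thesis
      proof (intro exI[of _ "smult (?z ^ (n - ?N)) R"] conjI allI)
        show "poly (smult (?z ^ (n - ?N)) R) t = form_section w n P (?b t ** g)" for t
          unfolding form_section_def pre col tail using True by (simp add: R mult.commute)
        show "coeff (smult (?z ^ (n - ?N)) R) 1 = form_section w n (scaled_deriv ?c P) g"
          using True R(2) by (simp add: form_section_def mult.commute)
      qed
    qed
  qed
qed


section \<open>Support varieties\<close>

lemma projective_H0_iff:
  fixes x :: "'k::alg_closed_field ^ 2 ^ 2"
  assumes "CHAR('k) > 0" "x \<in> lie_u" "x \<noteq> 0"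
  shows "projective_module trunc_poly_ring (restrict_to (H0 w n) x) \<longleftrightarrow> CHAR('k) dvd form_degree w n + 1"
proof -
  have "x $ 2 $ 1 \<noteq> 0"
    using assms(2,3) by (auto simp: lie_u_def vec_eq_iff forall_2)
  then have "derivation_model (H0 w n) x (form_section w n) (form_degree w n) (- (x $ 2 $ 1))"
    using assms
    by (intro derivation_model.intro)
      (simp_all add: abelian_monoid_H0 form_section_bij form_section_add form_section_zero
        form_section_smult lie_act_form_section)
  then show ?thesis
    by (rule derivation_model.projective_iff)
qed

lemma support_variety_H0:
  assumes "CHAR('k::alg_closed_field) > 0"
  shows "support_variety_B1 (H0 w n :: ('k, 'k ^ 2 ^ 2 \<Rightarrow> 'k) B_module) =
    (if CHAR('k) dvd form_degree w n + 1 then {0} else lie_u)"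
proof -
  have "(0 :: 'k ^ 2 ^ 2) \<in> lie_u"
    by (simp add: lie_u_def)
  then show ?thesis
    using projective_H0_iff[OF assms]
    by (auto simp: support_variety_B1_def nullcone_b_eq_lie_u[OF assms])
qed

theorem mainTheorem5:
  fixes p n :: nat
  assumes "CHAR('k::alg_closed_field) = p" and "p > 0"
  shows "support_variety_B1 (H0 W_e n :: ('k, 'k ^ 2 ^ 2 \<Rightarrow> 'k) B_module) = lie_u
       \<and> support_variety_B1 (H0 W_s n :: ('k, 'k ^ 2 ^ 2 \<Rightarrow> 'k) B_module) =
           (if p dvd n + 1 then {0} else lie_u)"
proof -
  have "CHAR('k) > 0"
    using assms by simp
  moreover have "\<not> CHAR('k) dvd 1"
    by simp
  ultimately show ?thesis
    using assms(1) by (simp add: support_variety_H0)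
qed

end
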